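(* Let $n\ge1$ and let $X_1,\dots,X_n,Z$ be real random variables on a common probability space, each absolutely continuous, such that $X_1,\dots,X_n$ are conditionally independent given $Z$. Let $F_{X_i}$ be the distribution function of $X_i$, let $C_{X_i,Z}$ be the copula of $(X_i,Z)$, and write $\dot C_{X_i,Z}(u,w)=\frac{\partial}{\partial w}C_{X_i,Z}(u,w)$. Let $X_{1:n}\le\dots\le X_{n:n}$ be the order statistics of $X_1,\dots,X_n$. Let $1\le r_1<r_2<\dots<r_k\le n$ and $-\infty<x_1<x_2<\dots<x_k<\infty$. Then $$P\{X_{r_1:n}\le x_1,\dots,X_{r_k:n}\le x_k\}=\sum\frac{1}{j_1!\,j_2!\cdots j_k!\,j_{k+1}!}\int_0^1\mathrm{Per}\big(M_{j_1,\dots,j_{k+1}}(x_1,\dots,x_k,w)\big)\,dw,$$ where the sum is over all nonnegative integers $j_1,\dots,j_{k+1}$ with $j_1\ge r_1$, $j_1+j_2\ge r_2$, $\dots$, $j_1+\dots+j_k\ge r_k$ and $j_1+\dots+j_{k+1}=n$, and $M_{j_1,\dots,j_{k+1}}(x_1,\dots,x_k,w)$ is the $n\times n$ matrix whose rows consist of: $j_1$ copies of the row with $m$-th entry $\dot C_{X_m,Z}(F_{X_m}(x_1),w)$; for each $p=2,\dots,k$, $j_p$ copies of the row with $m$-th entry $\dot C_{X_m,Z}(F_{X_m}(x_p),w)-\dot C_{X_m,Z}(F_{X_m}(x_{p-1}),w)$; and $j_{k+1}$ copies of the row with $m$-th entry $1-\dot C_{X_m,Z}(F_{X_m}(x_k),w)$,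 $m=1,\dots,n$.
   Context: The permanent of an $n\times n$ matrix $A=(a_{ij})$ is $\mathrm{Per}(A)=\sum_{(j_1,\dots,j_n)\in S_n}\prod_{k=1}^n a_{k,j_k}$, where $S_n$ is the set of all permutations of $(1,\dots,n)$. Let $F_Z$ be the distribution function of $Z$. The copula $C_{X_i,Z}$ is the unique distribution function on $[0,1]^2$ with uniform margins such that $P\{X_i\le x,Z\le z\}=C_{X_i,Z}(F_{X_i}(x),F_Z(z))$ for all $x,z$; for fixed $u$ its partial derivative in $w$ exists for almost every $w\in[0,1]$. The random variables $X_1,\dots,X_n$ are conditionally independent given $Z$ if for all $(x_1,\dots,x_n)\in\mathbb{R}^n$, $P\{X_1\le x_1,\dots,X_n\le x_n\mid Z=z\}=\prod_{i=1}^nP\{X_i\le x_i\mid Z=z\}$ for almost every $z$ with respect to the law of $Z$. *)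

theory Defs
  imports "HOL-Probability.Probability" "HOL-Combinatorics.Permutations"
begin

definition permanent :: "nat \<Rightarrow> (nat \<Rightarrow> nat \<Rightarrow> real) \<Rightarrow> real" where
  "permanent n A = (\<Sum>\<sigma> | \<sigma> permutes {1..n}. \<Prod>i=1..n. A i (\<sigma> i))"

text \<open>The distribution functions below are defined on the whole plane, so that a copula is
  a uniquely determined function; on the unit square this is the usual notion.\<close>

definition is_copula :: "(real \<Rightarrow> real \<Rightarrow> real) \<Rightarrow> bool" where
  "is_copula C \<longleftrightarrow>
     (\<exists>\<mu> :: (real \<times> real) measure. prob_space \<mu> \<and> sets \<mu> = sets borel
        \<and> distr \<mu> borel fst = uniform_measure lborel {0..1}
        \<and> distr \<mu> borel snd = uniform_measure lborel {0..1}
        \<and> (\<forall>u w. C u w = measure \<mu> ({..u} \<times> {..w})))"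

text \<open>The description is proper when both random variables have continuous distribution
  functions.\<close>

definition copula_of :: "'a measure \<Rightarrow> ('a \<Rightarrow> real) \<Rightarrow> ('a \<Rightarrow> real) \<Rightarrow> real \<Rightarrow> real \<Rightarrow> real" where
  "copula_of M X Z = (THE C. is_copula C \<and>
     (\<forall>x z. measure M {\<omega> \<in> space M. X \<omega> \<le> x \<and> Z \<omega> \<le> z}
        = C (cdf (distr M borel X) x) (cdf (distr M borel Z) z)))"

text \<open>The derivative exists for almost every \<open>w\<close> in the unit interval only; elsewhere
  the value is arbitrary.\<close>

definition copula_dot :: "'a measure \<Rightarrow> ('a \<Rightarrow> real) \<Rightarrow> ('a \<Rightarrow> real) \<Rightarrow> real \<Rightarrow> real \<Rightarrow> real" where
  "copula_dot M X Z u w = deriv (\<lambda>v. copula_of M X Z u v) w"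

text \<open>A version of \<open>P(A | Z = z)\<close> as a function of \<open>z\<close>: the Radon-Nikodym derivative of
  \<open>B \<mapsto> P(A \<inter> {Z \<in> B})\<close> with respect to the law of \<open>Z\<close>.\<close>

definition prob_given :: "'a measure \<Rightarrow> ('a \<Rightarrow> real) \<Rightarrow> 'a set \<Rightarrow> real \<Rightarrow> real" where
  "prob_given M Z A z =
     enn2real (RN_deriv (distr M borel Z) (distr (density M (indicator A)) borel Z) z)"

definition cond_indep_given ::
    "'a measure \<Rightarrow> ('i \<Rightarrow> 'a \<Rightarrow> real) \<Rightarrow> 'i set \<Rightarrow> ('a \<Rightarrow> real) \<Rightarrow> bool" where
  "cond_indep_given M X I Z \<longleftrightarrow>
     (\<forall>x :: 'i \<Rightarrow> real. AE z in distr M borel Z.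
        prob_given M Z {\<omega> \<in> space M. \<forall>i\<in>I. X i \<omega> \<le> x i} z
          = (\<Prod>i\<in>I. prob_given M Z {\<omega> \<in> space M. X i \<omega> \<le> x i} z))"

definition order_statistic :: "nat \<Rightarrow> (nat \<Rightarrow> 'a \<Rightarrow> real) \<Rightarrow> nat \<Rightarrow> 'a \<Rightarrow> real" where
  "order_statistic n X r \<omega> = sort (map (\<lambda>i. X i \<omega>) [1..<n+1]) ! (r - 1)"

definition block_row ::
    "'a measure \<Rightarrow> (nat \<Rightarrow> 'a \<Rightarrow> real) \<Rightarrow> ('a \<Rightarrow> real) \<Rightarrow> nat \<Rightarrow> (nat \<Rightarrow> real) \<Rightarrow> real
      \<Rightarrow> nat \<Rightarrow> nat \<Rightarrow> real" where
  "block_row M X Z k x w p m =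
     (let D = (\<lambda>q. copula_dot M (X m) Z (cdf (distr M borel (X m)) (x q)) w)
      in if p = 1 then D 1
         else if p \<le> k then D p - D (p - 1)
         else 1 - D k)"

definition block_matrix ::
    "'a measure \<Rightarrow> (nat \<Rightarrow> 'a \<Rightarrow> real) \<Rightarrow> ('a \<Rightarrow> real) \<Rightarrow> nat \<Rightarrow> (nat \<Rightarrow> nat) \<Rightarrow> (nat \<Rightarrow> real) \<Rightarrow> real
      \<Rightarrow> nat \<Rightarrow> nat \<Rightarrow> real" where
  "block_matrix M X Z k j x w i =
     concat (map (\<lambda>p. replicate (j p) (block_row M X Z k x w p)) [1..<k+2]) ! (i - 1)"

text \<open>Tuples \<open>(j 1, \<dots>, j (k+1))\<close> are extensional functions on \<open>{1..k+1}\<close>; there are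
  finitely many of them because their entries add up to \<open>n\<close>.\<close>

definition block_sizes :: "nat \<Rightarrow> nat \<Rightarrow> (nat \<Rightarrow> nat) \<Rightarrow> (nat \<Rightarrow> nat) set" where
  "block_sizes n k r = {j \<in> {1..k+1} \<rightarrow>\<^sub>E UNIV.
     (\<forall>p\<in>{1..k}. r p \<le> (\<Sum>q=1..p. j q)) \<and> (\<Sum>q=1..k+1. j q) = n}"

end

theory Submission
  imports Defs
begin

text \<open>
  The points \<open>x\<^sub>1 < \<dots> < x\<^sub>k\<close> cut the line into \<open>k + 1\<close> bins. The event on the order statistics depends only on the numbers
  \<open>j\<^sub>p\<close> of variables that fall into the bins (\<open>order_statistics_le_iff_colour_counts\<close>), so its probability is the sum, over
  all admissible assignments \<open>b\<close> of variables to bins, of the probability that every \<open>X\<^sub>i\<close> lies in its bin \<open>b i\<close>.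

  Put \<open>W = F\<^sub>Z(Z)\<close>, which is uniform on \<open>[0, 1]\<close>. Conditioning on \<open>Z\<close> and conditioning on \<open>W\<close> are the same
  (\<open>prob_given_eq_cond_prob_version\<close>), so by conditional independence the probability of an assignment is
  \<open>\<integral>\<^sub>0\<^sup>1 \<Prod>\<^sub>i P(X\<^sub>i \<in> B\<^bsub>b i\<^esub> | W = w) dw\<close>, where \<open>B\<^sub>p\<close> is the bin \<open>p\<close> (\<open>emeasure_borel_product\<close>). The copula
  satisfies \<open>C(F\<^sub>X(x), v) = P(X \<le> x, W \<le> v)\<close> (\<open>copula_of_cdf\<close>). By Lebesgue's differentiation theorem
  (\<open>AE_lebesgue_differentiation\<close>) its derivative in \<open>v\<close> is \<open>P(X \<le> x | W = v)\<close> for almost every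
  \<open>v\<close>. Hence the integrand is a product of entries of the block rows (\<open>prob_bins_eq_integral\<close>).

  Finally, expand the permanent of a matrix with \<open>j\<^sub>p\<close> copies of row \<open>p\<close>. A permutation assigns a block to each column, and each
  assignment with block frequencies \<open>j\<close> comes from exactly \<open>j\<^sub>1! \<dots> j\<^bsub>k+1\<^esub>!\<close> permutations
  (\<open>sum_permutations_eq_sum_colourings\<close>). So the permanent divided by these factorials is the sum of the products over all
  assignments with counts \<open>j\<close>.
\<close>

section \<open>Lebesgue differentiation of bounded functions\<close>

lemma set_integrable_Icc_bounded:
  fixes f :: "real \<Rightarrow> real"
  assumes [measurable]: "f \<in> borel_measurable borel"
    and f0: "\<And>t. 0 \<le> f t" and f1: "\<And>t. f t \<le> 1"
  shows "set_integrable lborel {c..d} f"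
  unfolding set_integrable_def real_scaleR_def
  by (rule Bochner_Integration.integrable_bound[where f="indicator {c..d} :: real \<Rightarrow> real"])
     (use f0 f1 in \<open>auto simp: indicator_def integrable_indicator_iff emeasure_lborel_Icc_eq\<close>)

lemma nn_integral_Icc_bounded:
  fixes f :: "real \<Rightarrow> real"
  assumes [measurable]: "f \<in> borel_measurable borel"
    and f0: "\<And>t. 0 \<le> f t" and f1: "\<And>t. f t \<le> 1"
  shows "(\<integral>\<^sup>+t. ennreal (f t) * indicator {c..d} t \<partial>lborel) = ennreal (LBINT t:{c..d}. f t)"
proof -
  have "(\<integral>\<^sup>+t. ennreal (f t) * indicator {c..d} t \<partial>lborel) = (\<integral>\<^sup>+t. ennreal (indicator {c..d} t * f t) \<partial>lborel)"
    by (intro nn_integral_cong) (auto simp: indicator_def)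
  also have "\<dots> = ennreal (LBINT t:{c..d}. f t)"
    using set_integrable_Icc_bounded[OF assms, of c d] f0
    unfolding set_lebesgue_integral_def set_integrable_def real_scaleR_def
    by (intro nn_integral_eq_integral) auto
  finally show ?thesis .
qed

text \<open>The half of Lebesgue's differentiation theorem that carries the work. Enclose \<open>{f \<le> p}\<close> in an open set \<open>U\<close>
  of almost the same measure. The short intervals inside \<open>U\<close> on which \<open>f\<close> has mean value greater than \<open>q\<close> form a Vitali cover
  of the exceptional set, so a countable disjoint subfamily with union \<open>T\<close> covers it up to a null set. Then
  \<open>q |T| < \<integral>\<^sub>T f \<le> p |T| + |U - {f \<le> p}|\<close> makes \<open>|T|\<close> small, because \<open>f \<le> 1\<close>.\<close>

lemma negligible_upper_derivate_gt:
  fixes f :: "real \<Rightarrow> real"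
  assumes [measurable]: "f \<in> borel_measurable borel"
    and f0: "\<And>t. 0 \<le> f t" and f1: "\<And>t. f t \<le> 1" and pq: "p < q"
  shows "negligible {w \<in> {0<..<1}. f w \<le> p \<and> (\<forall>\<delta>>0. \<exists>c d. c \<le> w \<and> w \<le> d \<and> c < d \<and> d - c < \<delta>
           \<and> q * (d - c) < (LBINT t:{c..d}. f t))}" (is "negligible ?E")
proof (cases "?E = {}")
  case True
  then show ?thesis by (metis negligible_empty)
next
  case False
  then obtain w0 where "f w0 \<le> p" by auto
  with f0[of w0] have p0: "0 \<le> p" by simp
  with pq have q0: "0 < q" by simp
  define A where "A = {w \<in> {0<..<1}. f w \<le> p}"
  have A[measurable]: "A \<in> sets borel"
    unfolding A_def by measurable
  show ?thesis
    unfolding negligible_outer_le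
  proof (intro allI impI)
    fix e :: real assume e: "0 < e"
    obtain U where U: "open U" "A \<subseteq> U" "U - A \<in> lmeasurable"
      and Ue: "emeasure lebesgue (U - A) < ennreal (e * (q - p))"
      using sets_lebesgue_outer_open[of A "e * (q - p)"] e pq A by (auto simp: sets_completionI_sets)
    define V where "V = U \<inter> {0<..<1}"
    have V: "open V" using U by (auto simp: V_def)
    define K where "K = {(c, d). c < d \<and> {c..d} \<subseteq> V \<and> q * (d - c) < (LBINT t:{c..d}. f t)}"
    have cb: "cball ((fst i + snd i) / 2) ((snd i - fst i) / 2) = {fst i..snd i}" for i :: "real \<times> real"
      by (auto simp: cball_eq_atLeastAtMost field_simps)
    obtain C where C: "countable C" "C \<subseteq> K"
      and disj: "pairwise (\<lambda>i j. disjnt {fst i..snd i} {fst j..snd j}) C"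
      and neg: "negligible (?E - (\<Union>i\<in>C. {fst i..snd i}))"
    proof (rule Vitali_covering_theorem_cballs[of K "\<lambda>i. (snd i - fst i) / 2" ?E "\<lambda>i. (fst i + snd i) / 2"])
      show "0 < (snd i - fst i) / 2" if "i \<in> K" for i using that by (auto simp: K_def)
    next
      fix w s :: real assume w: "w \<in> ?E" and s: "0 < s"
      (* An interval around w that is shorter than b stays inside V. *)
      have "w \<in> V" using w U(2) by (auto simp: V_def A_def)
      then obtain b where b: "b > 0" "ball w b \<subseteq> V" using V openE by blast
      obtain c d where cd: "c \<le> w" "w \<le> d" "c < d" "d - c < min s b" "q * (d - c) < (LBINT t:{c..d}. f t)"
        using w s b(1) by (auto dest!: spec[of _ "min s b"])
      have "{c..d} \<subseteq> ball w b" using cd by (auto simp: dist_real_def)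
      then have "(c, d) \<in> K" using cd b by (auto simp: K_def)
      then show "\<exists>i. i \<in> K \<and> w \<in> cball ((fst i + snd i) / 2) ((snd i - fst i) / 2) \<and> (snd i - fst i) / 2 < s"
        using cd s unfolding cb by (intro exI[of _ "(c,d)"]) auto
    qed (rule that, simp_all only: cb)
    define T where "T = (\<Union>i\<in>C. {fst i..snd i})"
    have T[measurable]: "T \<in> sets borel"
      unfolding T_def using C(1) by (intro sets.countable_UN'') auto
    have TV: "T \<subseteq> V" using C(2) by (fastforce simp: T_def K_def)
    have dj: "disjoint_family_on (\<lambda>i. {fst i..snd i}) C"
      using disj by (auto simp: disjoint_family_on_def pairwise_def disjnt_def)
    have one: "ennreal q * emeasure lborel {fst i..snd i} \<le> emeasure (density lborel f) {fst i..snd i}" if "i \<in> C" for i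
    proof -
      have i: "fst i < snd i" "q * (snd i - fst i) < (LBINT t:{fst i..snd i}. f t)"
        using that C(2) by (auto simp: K_def)
      have "emeasure (density lborel f) {fst i..snd i} = ennreal (LBINT t:{fst i..snd i}. f t)"
        using nn_integral_Icc_bounded[OF assms(1-3)] by (subst emeasure_density) auto
      also have "\<dots> \<ge> ennreal (q * (snd i - fst i))" using i by (intro ennreal_leI) simp
      finally show ?thesis using i q0 by (simp add: ennreal_mult)
    qed
    have "ennreal q * emeasure lborel T = (\<integral>\<^sup>+i. ennreal q * emeasure lborel {fst i..snd i} \<partial>count_space C)"
      unfolding T_def using C(1) dj
      by (subst emeasure_UN_countable) (auto simp: nn_integral_cmult)
    also have "\<dots> \<le> (\<integral>\<^sup>+i. emeasure (density lborel f) {fst i..snd i} \<partial>count_space C)"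
      using one by (intro nn_integral_mono) auto
    also have "\<dots> = emeasure (density lborel f) T"
      unfolding T_def using C(1) dj by (subst emeasure_UN_countable) auto
    also have "\<dots> = (\<integral>\<^sup>+t. ennreal (f t) * indicator T t \<partial>lborel)"
      by (subst emeasure_density) auto
    also have "\<dots> \<le> (\<integral>\<^sup>+t. ennreal p * indicator T t + indicator (T - A) t \<partial>lborel)"
    proof (intro nn_integral_mono)
      fix t
      show "ennreal (f t) * indicator T t \<le> ennreal p * indicator T t + indicator (T - A) t"
      proof (cases "t \<in> A")
        case True
        then show ?thesis by (auto simp: A_def indicator_def intro: ennreal_leI)
      next
        case False
        have "ennreal (f t) \<le> ennreal p + 1"
          using f1[of t] p0 by (metis add_increasing ennreal_1 ennreal_leI ennreal_plus zero_le_one)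
        then show ?thesis using False by (cases "t \<in> T") simp_all
      qed
    qed
    also have "\<dots> = ennreal p * emeasure lborel T + emeasure lborel (T - A)"
      by (subst nn_integral_add) (auto simp: nn_integral_cmult)
    also have "emeasure lborel (T - A) = emeasure lebesgue (T - A)" by simp
    also have "emeasure lebesgue (T - A) \<le> emeasure lebesgue (U - A)"
      using TV U(3) by (intro emeasure_mono) (auto simp: V_def fmeasurableD)
    finally have main: "ennreal q * emeasure lborel T \<le> ennreal p * emeasure lborel T + emeasure lebesgue (U - A)"
      by (simp add: add_left_mono)
    have "emeasure lborel T \<le> emeasure lborel {0<..<1::real}"
      using TV by (intro emeasure_mono) (auto simp: V_def)
    then have Tfin: "emeasure lborel T < \<infinity>" by (simp add: le_less_trans)
    then have mT: "emeasure lborel T = ennreal (measure lborel T)"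
      by (simp add: emeasure_eq_ennreal_measure less_top)
    define m u where "m = measure lborel T" and "u = measure lebesgue (U - A)"
    have m0: "0 \<le> m" and u0: "0 \<le> u" by (auto simp: m_def u_def)
    have eU: "emeasure lebesgue (U - A) = ennreal u"
      using U(3) by (simp add: emeasure_eq_measure2 u_def)
    have "ennreal (q * m) \<le> ennreal (p * m + u)"
      using main p0 q0 m0 u0 unfolding mT eU m_def[symmetric]
      by (simp add: ennreal_mult'')
    then have "q * m \<le> p * m + u" using p0 m0 u0 by (subst (asm) ennreal_le_iff) auto
    moreover have "u < e * (q - p)" using Ue u0 unfolding eU by (subst (asm) ennreal_less_iff) auto
    ultimately have "q * measure lborel T \<le> p * measure lborel T + measure lebesgue (U - A)"
      "measure lebesgue (U - A) < e * (q - p)"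
      unfolding m_def u_def by auto
    then have "(q - p) * measure lborel T < (q - p) * e" by (simp add: algebra_simps)
    then have less: "measure lborel T < e" using pq by simp
    have Tl: "T \<in> lmeasurable"
      using Tfin by (auto simp: fmeasurable_def)
    show "\<exists>T. ?E \<subseteq> T \<and> T \<in> lmeasurable \<and> measure lebesgue T \<le> e"
    proof (intro exI conjI)
      show "?E \<subseteq> T \<union> (?E - T)" by blast
      have n: "negligible (?E - T)" using neg by (simp add: T_def)
      show "T \<union> (?E - T) \<in> lmeasurable" 
        using Tl negligible_imp_measurable[OF n] by (rule fmeasurable.Un)
      show "measure lebesgue (T \<union> (?E - T)) \<le> e"
        using measure_Un_le[OF fmeasurableD[OF Tl] negligible_imp_sets[OF n]] less
        unfolding negligible_imp_measure0[OF n] by simp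
    qed
  qed
qed

text \<open>Off a null set, and with \<open>p\<close>, \<open>q\<close> ranging over the rationals, the previous lemma bounds the mean values of \<open>f\<close> over short
  intervals around \<open>w\<close> by \<open>f w + e\<close>. The same bound for \<open>1 - f\<close>, which has the same range \<open>[0, 1]\<close>, is the lower bound.\<close>

lemma AE_lebesgue_differentiation:
  fixes f :: "real \<Rightarrow> real"
  assumes [measurable]: "f \<in> borel_measurable borel"
    and f0: "\<And>t. 0 \<le> f t" and f1: "\<And>t. f t \<le> 1"
    and F: "\<And>c d. 0 < c \<Longrightarrow> c < d \<Longrightarrow> d < 1 \<Longrightarrow> F d - F c = (LBINT t:{c..d}. f t)"
  shows "AE w in lebesgue. w \<in> {0<..<1} \<longrightarrow> (F has_real_derivative f w) (at w)"
proof -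
  define E where "E g p q = {w \<in> {0<..<1}. g w \<le> p \<and> (\<forall>\<delta>>0. \<exists>c d. c \<le> w \<and> w \<le> d \<and> c < d \<and> d - c < \<delta>
           \<and> q * (d - c) < (LBINT t:{c..d}. g t))}" for g :: "real \<Rightarrow> real" and p q :: real
  define N where "N g = (\<Union>(p, q)\<in>{(p, q). p \<in> \<rat> \<and> q \<in> \<rat> \<and> p < q}. E g p q)" for g
  have cnt: "countable {(p, q). p \<in> \<rat> \<and> q \<in> \<rat> \<and> p < (q::real)}"
    by (rule countable_subset[of _ "\<rat> \<times> \<rat>"]) (auto intro: countable_rat)
  have N: "negligible (N g)" if "g \<in> borel_measurable borel" "\<And>t. 0 \<le> g t" "\<And>t. g t \<le> 1" for g
    unfolding N_def E_def
    by (rule negligible_countable_Union[OF countable_image[OF cnt]])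
       (use negligible_upper_derivate_gt[OF that] in auto)
  have upper: "\<exists>\<delta>>0. \<forall>c d. c \<le> w \<and> w \<le> d \<and> c < d \<and> d - c < \<delta> \<longrightarrow> (LBINT t:{c..d}. g t) \<le> (g w + e) * (d - c)"
    if "w \<notin> N g" "w \<in> {0<..<1}" "0 < e" for g w e
  proof -
    obtain p where p: "p \<in> \<rat>" "g w < p" "p < g w + e"
      using Rats_dense_in_real[of "g w" "g w + e"] \<open>0 < e\<close> by auto
    obtain q where q: "q \<in> \<rat>" "p < q" "q < g w + e"
      using Rats_dense_in_real[of p "g w + e"] p by auto
    have "w \<notin> E g p q" using that(1) p q unfolding N_def by blast
    then have "\<not> (\<forall>\<delta>>0. \<exists>c d. c \<le> w \<and> w \<le> d \<and> c < d \<and> d - c < \<delta> \<and> q * (d - c) < (LBINT t:{c..d}. g t))"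
      using that(2) less_imp_le[OF p(2)] unfolding E_def by blast
    then obtain \<delta> where \<delta>: "\<delta> > 0" "\<And>c d. c \<le> w \<Longrightarrow> w \<le> d \<Longrightarrow> c < d \<Longrightarrow> d - c < \<delta> \<Longrightarrow> (LBINT t:{c..d}. g t) \<le> q * (d - c)"
      by (meson not_le_imp_less)
    have "q * (d - c) \<le> (g w + e) * (d - c)" if "c < d" for c d
      using that q by (intro mult_right_mono) auto
    then show ?thesis using \<delta> by (meson order_trans)
  qed
  have "negligible (N f \<union> N (\<lambda>t. 1 - f t))"
    using f0 f1 by (intro negligible_Un N) auto
  then have "AE w in lebesgue. w \<notin> N f \<union> N (\<lambda>t. 1 - f t)"
    unfolding negligible_iff_null_sets by (rule AE_not_in)
  then show ?thesis
  proof eventually_elim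
    case (elim w)
    show ?case
    proof
      assume w: "w \<in> {0<..<1}"
      have int: "set_integrable lborel {c..d} f" for c d
        by (rule set_integrable_Icc_bounded[OF assms(1-3)])
      have compl: "(LBINT t:{c..d}. 1 - f t) = (d - c) - (LBINT t:{c..d}. f t)" if "c < d" for c d
        using that int[of c d] by (subst set_integral_diff) (auto simp: set_integrable_def set_lebesgue_integral_def integrable_indicator_iff)
      show "(F has_real_derivative f w) (at w)"
        unfolding has_field_derivative_iff
      proof (rule LIM_I)
        fix e :: real assume e: "0 < e"
        have e2: "0 < e/2" and nN: "w \<notin> N f" "w \<notin> N (\<lambda>t. 1 - f t)" using e elim by auto
        obtain \<delta>1 where d1: "\<delta>1 > 0" "\<And>c d. c \<le> w \<Longrightarrow> w \<le> d \<Longrightarrow> c < d \<Longrightarrow> d - c < \<delta>1 \<Longrightarrow> (LBINT t:{c..d}. f t) \<le> (f w + e/2) * (d - c)"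
          using upper[OF nN(1) w e2] by blast
        obtain \<delta>2 where d2: "\<delta>2 > 0" "\<And>c d. c \<le> w \<Longrightarrow> w \<le> d \<Longrightarrow> c < d \<Longrightarrow> d - c < \<delta>2 \<Longrightarrow> (LBINT t:{c..d}. 1 - f t) \<le> (1 - f w + e/2) * (d - c)"
          using upper[OF nN(2) w e2] by blast
        define \<delta> where "\<delta> = min (min \<delta>1 \<delta>2) (min w (1 - w))"
        have bnd: "\<bar>(F d - F c) / (d - c) - f w\<bar> < e"
          if cd: "c \<le> w" "w \<le> d" "c < d" "d - c < \<delta>" for c d
        proof -
          have "F d - F c = (LBINT t:{c..d}. f t)" using cd w by (intro F) (auto simp: \<delta>_def)
          then have "F d - F c \<le> (f w + e/2) * (d - c)" "(d - c) - (F d - F c) \<le> (1 - f w + e/2) * (d - c)"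
            using d1(2)[of c d] d2(2)[of c d] cd compl[of c d] by (auto simp: \<delta>_def)
          then have "(F d - F c) / (d - c) \<le> f w + e/2" "f w - e/2 \<le> (F d - F c) / (d - c)"
            using cd pos_divide_le_eq[of "d - c" "F d - F c" "f w + e/2"] pos_le_divide_eq[of "d - c" "f w - e/2" "F d - F c"]
            by (simp_all add: algebra_simps)
          then show ?thesis using e by linarith
        qed
        show "\<exists>s>0. \<forall>y. y \<noteq> w \<and> norm (y - w) < s \<longrightarrow> norm ((F y - F w) / (y - w) - f w) < e"
        proof (intro exI[of _ \<delta>] conjI allI impI)
          show "0 < \<delta>" using d1 d2 w by (auto simp: \<delta>_def)
          fix y assume y: "y \<noteq> w \<and> norm (y - w) < \<delta>"
          show "norm ((F y - F w) / (y - w) - f w) < e"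
          proof (cases "w < y")
            case True
            then show ?thesis using bnd[of w y] y by simp
          next
            case False
            have "(F y - F w) / (y - w) = (F w - F y) / (w - y)"
              using minus_divide_divide[of "F w - F y" "w - y"] by simp
            then show ?thesis using False bnd[of y w] y by simp
          qed
        qed
      qed
    qed
  qed
qed

section \<open>The probability integral transform\<close>

lemma (in prob_space) isCont_cdf_distr:
  assumes [measurable]: "Z \<in> borel_measurable M"
    and ac: "absolutely_continuous lborel (distr M borel Z)"
  shows "isCont (cdf (distr M borel Z)) z"
proof -
  interpret Z: real_distribution "distr M borel Z" by simp
  have "{z} \<in> null_sets (distr M borel Z)"
    using ac unfolding absolutely_continuous_def by (rule subsetD) auto
  then show ?thesis by (simp add: Z.isCont_cdf measure_def null_sets_def)
qed

lemma (in real_distribution) cdf_attains: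
  assumes cont: "\<And>z. isCont (cdf M) z" and u: "0 < u" "u < 1"
  shows "\<exists>z. cdf M z = u"
proof -
  have "eventually (\<lambda>x. cdf M x < u) at_bot" "eventually (\<lambda>x. u < cdf M x) at_top"
    using order_tendstoD[OF cdf_lim_at_bot] order_tendstoD[OF cdf_lim_at_top_prob] u by blast+
  then obtain a b where ab: "\<And>x. x \<le> a \<Longrightarrow> cdf M x < u" "\<And>x. b \<le> x \<Longrightarrow> u < cdf M x"
    unfolding eventually_at_bot_linorder eventually_at_top_linorder by blast
  have "cdf M (min a b) < u" "u < cdf M (max a b)" using ab by auto
  then show ?thesis
    using IVT[of "cdf M" "min a b" u "max a b"] cont by (force intro: less_imp_le)
qed

text \<open>The set \<open>{y. F y \<le> F z}\<close> may reach beyond \<open>z\<close> where \<open>F\<close> is flat, but it is a closed half-line \<open>{..s}\<close> (or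
  everything), and \<open>F s \<le> F z\<close> shows that the excess carries no mass.\<close>

lemma (in real_distribution) prob_cdf_le_cdf:
  assumes cont: "\<And>z. isCont (cdf M) z"
  shows "prob {y. cdf M y \<le> cdf M z} = cdf M z"
proof -
  have F[measurable]: "cdf M \<in> borel_measurable borel"
    by (intro borel_measurable_mono monoI cdf_nondecreasing)
  let ?S = "{y. cdf M y \<le> cdf M z}"
  have S: "?S \<in> events" by simp
  show ?thesis
  proof (cases "cdf M z = 1")
    case True
    then have "?S = UNIV" using cdf_bounded_prob by auto
    then show ?thesis using True prob_space by simp
  next
    case False
    then have "cdf M z < 1" using cdf_bounded_prob[of z] by simp
    then obtain b where b: "\<And>x. b \<le> x \<Longrightarrow> cdf M z < cdf M x"
      using order_tendstoD(1)[OF cdf_lim_at_top_prob] unfolding eventually_at_top_linorder by blast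
    have bd: "bdd_above ?S"
      using b by (intro bdd_aboveI[of _ b]) (meson mem_Collect_eq not_le linear)
    have cl: "closed ?S"
      using cont by (intro closed_Collect_le continuous_on_const continuous_at_imp_continuous_on) auto
    have "Sup ?S \<in> ?S"
      by (rule closed_contains_Sup) (use bd cl in auto)
    then have le: "cdf M (Sup ?S) \<le> cdf M z" by simp
    have "prob ?S \<le> cdf M (Sup ?S)"
      unfolding cdf_def2[of M "Sup ?S"] using bd by (intro finite_measure_mono) (auto intro: cSup_upper)
    moreover have "cdf M z \<le> prob ?S"
      unfolding cdf_def2[of M z] using cdf_nondecreasing
      by (intro finite_measure_mono S) (auto simp: cdf_def2[symmetric])
    ultimately show ?thesis using le by simp
  qed
qed

definition cdf_transform :: "'a measure \<Rightarrow> ('a \<Rightarrow> real) \<Rightarrow> 'a \<Rightarrow> real" where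
  "cdf_transform M Z \<omega> = cdf (distr M borel Z) (Z \<omega>)"

lemma (in prob_space) measurable_cdf[measurable]:
  assumes [measurable]: "Z \<in> borel_measurable M"
  shows "cdf (distr M borel Z) \<in> borel_measurable borel"
proof -
  interpret Z: real_distribution "distr M borel Z" by simp
  show ?thesis by (intro borel_measurable_mono monoI Z.cdf_nondecreasing)
qed

lemma (in prob_space) measurable_cdf_transform[measurable]:
  "Z \<in> borel_measurable M \<Longrightarrow> cdf_transform M Z \<in> borel_measurable M"
  unfolding cdf_transform_def[abs_def] by measurable

text \<open>Passing from \<open>Z\<close> to \<open>F\<^sub>Z(Z)\<close> loses no information: the events \<open>{Z \<le> z}\<close> and \<open>{F\<^sub>Z(Z) \<le> F\<^sub>Z(z)}\<close> are nested
  and have the same probability. This is what lets the conditioning variable be made uniform, and it also evaluates the copula.\<close>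

lemma (in prob_space) AE_cdf_transform_le_iff:
  assumes [measurable]: "Z \<in> borel_measurable M"
    and cont: "\<And>z. isCont (cdf (distr M borel Z)) z"
  shows "AE \<omega> in M. cdf_transform M Z \<omega> \<le> cdf (distr M borel Z) z \<longleftrightarrow> Z \<omega> \<le> z"
proof -
  interpret Z: real_distribution "distr M borel Z" by simp
  let ?F = "cdf (distr M borel Z)"
  let ?A = "{\<omega>\<in>space M. ?F (Z \<omega>) \<le> ?F z}" and ?B = "{\<omega>\<in>space M. Z \<omega> \<le> z}"
  have "prob ?A = measure (distr M borel Z) {y. ?F y \<le> ?F z}"
    by (subst measure_distr) (auto intro!: arg_cong[where f=prob])
  also have "\<dots> = ?F z" by (rule Z.prob_cdf_le_cdf[OF cont])
  also have "\<dots> = prob ?B"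
    unfolding cdf_def2 by (subst measure_distr) (auto intro!: arg_cong[where f=prob])
  finally have eq: "prob ?A = prob ?B" .
  have "?B \<subseteq> ?A" using Z.cdf_nondecreasing by auto
  then have "prob (?A - ?B) = 0" using eq by (subst finite_measure_Diff) auto
  then have "AE \<omega> in M. \<omega> \<notin> ?A - ?B"
    by (intro AE_not_in) (auto simp: null_sets_def emeasure_eq_measure)
  then show ?thesis
    using AE_space by eventually_elim (auto simp: cdf_transform_def Z.cdf_nondecreasing)
qed

lemma measure_uniform_01_atMost:
  "measure (uniform_measure lborel {0..1}) {..w::real} = max 0 (min 1 w)"
proof -
  have "{0..1} \<inter> {..w} = {0..min 1 w}" by auto
  then show ?thesis by (subst measure_uniform_measure) auto
qed

lemma prob_space_uniform_01: "prob_space (uniform_measure lborel {0..1::real})"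
  by (rule prob_space_uniform_measure) auto

lemma (in prob_space) distr_cdf_transform:
  assumes [measurable]: "Z \<in> borel_measurable M"
    and cont: "\<And>z. isCont (cdf (distr M borel Z)) z"
  shows "distr M borel (cdf_transform M Z) = uniform_measure lborel {0..1}"
proof (rule cdf_unique)
  interpret Z: real_distribution "distr M borel Z" by simp
  let ?W = "cdf_transform M Z"
  show "real_distribution (distr M borel ?W)" by simp
  interpret W: real_distribution "distr M borel ?W" by simp
  show "real_distribution (uniform_measure lborel {0..1::real})"
    using prob_space_uniform_01 by (simp add: real_distribution_def real_distribution_axioms_def)
  have W: "cdf (distr M borel ?W) w = prob {\<omega>\<in>space M. ?W \<omega> \<le> w}" for w
    unfolding cdf_def2 by (subst measure_distr) (auto intro!: arg_cong[where f=prob])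
  have mid: "cdf (distr M borel ?W) w = w" if w: "0 < w" "w < 1" for w
  proof -
    obtain z where z: "cdf (distr M borel Z) z = w" using Z.cdf_attains[OF cont w] by blast
    have "prob {\<omega>\<in>space M. ?W \<omega> \<le> w} = prob {\<omega>\<in>space M. Z \<omega> \<le> z}"
      using AE_cdf_transform_le_iff[OF _ cont, of z] unfolding z
      by (intro finite_measure_eq_AE) auto
    also have "\<dots> = cdf (distr M borel Z) z"
      unfolding cdf_def2 by (subst measure_distr) (auto intro!: arg_cong[where f=prob])
    finally show ?thesis using W z by simp
  qed
  have low: "cdf (distr M borel ?W) w = 0" if "w \<le> 0" for w
  proof -
    have "cdf (distr M borel ?W) w \<le> e" if "0 < e" "e < 1" for e
      using mid[OF that] W.cdf_nondecreasing[of w e] that \<open>w \<le> 0\<close> by simp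
    from this[of "cdf (distr M borel ?W) w / 2"] show ?thesis
      using W.cdf_nonneg[of w] W.cdf_bounded_prob[of w] by linarith
  qed
  have high: "cdf (distr M borel ?W) w = 1" if "1 \<le> w" for w
  proof -
    have "prob {\<omega>\<in>space M. ?W \<omega> \<le> w} = prob (space M)"
      using that by (intro arg_cong[where f=prob])
        (auto simp: cdf_transform_def intro: order_trans[OF Z.cdf_bounded_prob])
    then show ?thesis using W prob_space by simp
  qed
  show "cdf (distr M borel ?W) = cdf (uniform_measure lborel {0..1})"
  proof
    fix w
    show "cdf (distr M borel ?W) w = cdf (uniform_measure lborel {0..1}) w"
      using mid[of w] low[of w] high[of w] unfolding cdf_def2[of "uniform_measure _ _"] measure_uniform_01_atMost
      by linarith
  qed
qed

section \<open>The copula of two continuously distributed random variables\<close>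

lemma measurable_fst_borel: "fst \<in> borel_measurable (borel :: (real \<times> real) measure)"
  by (rule borel_measurable_continuous_onI[OF continuous_on_fst[OF continuous_on_id]])

lemma measurable_snd_borel: "snd \<in> borel_measurable (borel :: (real \<times> real) measure)"
  by (rule borel_measurable_continuous_onI[OF continuous_on_snd[OF continuous_on_id]])

text \<open>The range of a continuous distribution function contains \<open>(0, 1)\<close> but perhaps neither end point, so agreement on the range
  determines a copula only on the open square. Everywhere else the uniform margins fix its values.\<close>

lemma is_copula_eqI:
  assumes C1: "is_copula C1" and C2: "is_copula C2"
    and eq: "\<And>u w. 0 < u \<Longrightarrow> u < 1 \<Longrightarrow> 0 < w \<Longrightarrow> w < 1 \<Longrightarrow> C1 u w = C2 u w"
  shows "C1 = C2"
proof -
  let ?U = "uniform_measure lborel {0..1::real}"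
  have bd: "(u \<le> 0 \<longrightarrow> C u w = 0) \<and> (w \<le> 0 \<longrightarrow> C u w = 0) \<and> (1 \<le> u \<longrightarrow> C u w = measure ?U {..w})
      \<and> (1 \<le> w \<longrightarrow> C u w = measure ?U {..u})" if cop: "is_copula C" for C u w
  proof -
    obtain \<mu> :: "(real \<times> real) measure" where \<mu>: "prob_space \<mu>" "sets \<mu> = sets borel"
      "distr \<mu> borel fst = ?U" "distr \<mu> borel snd = ?U" "\<And>u w. C u w = measure \<mu> ({..u} \<times> {..w})"
      using cop unfolding is_copula_def by (elim exE conjE) blast
    interpret prob_space \<mu> by fact
    have sp: "space \<mu> = UNIV" using sets_eq_imp_space_eq[OF \<mu>(2)] by simp
    note [measurable_cong] = \<mu>(2)
    have [measurable]: "fst \<in> borel_measurable \<mu>" "snd \<in> borel_measurable \<mu>"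
      unfolding measurable_cong_sets[OF \<mu>(2) refl] by (rule measurable_fst_borel measurable_snd_borel)+
    have f: "prob ({..u} \<times> UNIV) = max 0 (min 1 u)" for u
    proof -
      have "prob ({..u} \<times> UNIV) = measure (distr \<mu> borel fst) {..u}"
        by (subst measure_distr) (auto intro!: arg_cong[where f=prob] simp: sp)
      then show ?thesis unfolding \<mu>(3) measure_uniform_01_atMost .
    qed
    have s: "prob (UNIV \<times> {..u}) = max 0 (min 1 u)" for u
    proof -
      have "prob (UNIV \<times> {..u}) = measure (distr \<mu> borel snd) {..u}"
        by (subst measure_distr) (auto intro!: arg_cong[where f=prob] simp: sp)
      then show ?thesis unfolding \<mu>(4) measure_uniform_01_atMost .
    qed
    have ev: "{..u} \<times> UNIV \<in> events" "UNIV \<times> {..w} \<in> events" "{..u} \<times> {..w} \<in> events" for u w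
      unfolding \<mu>(2) by (auto intro!: borel_closed closed_Times)
    have one: "AE p in \<mu>. p \<in> {..u} \<times> UNIV" if "1 \<le> u" for u
      using f[of u] that by (subst AE_in_set_eq_1) (auto simp: ev)
    have one': "AE p in \<mu>. p \<in> UNIV \<times> {..u}" if "1 \<le> u" for u
      using s[of u] that by (subst AE_in_set_eq_1) (auto simp: ev)
    show ?thesis
    proof (intro conjI impI)
      assume "u \<le> 0"
      then show "C u w = 0"
        using finite_measure_mono[of "{..u} \<times> {..w}" "{..u} \<times> UNIV", OF _ ev(1)] f[of u] measure_nonneg[of \<mu> "{..u} \<times> {..w}"]
        unfolding \<mu>(5) by (simp add: subset_eq)
    next
      assume "w \<le> 0"
      then show "C u w = 0"
        using finite_measure_mono[of "{..u} \<times> {..w}" "UNIV \<times> {..w}", OF _ ev(2)] s[of w] measure_nonneg[of \<mu> "{..u} \<times> {..w}"]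
        unfolding \<mu>(5) by (simp add: subset_eq)
    next
      assume "1 \<le> u"
      have "prob ({..u} \<times> {..w}) = prob (UNIV \<times> {..w})"
        using one[OF \<open>1 \<le> u\<close>] by (intro finite_measure_eq_AE) (auto simp: ev)
      then show "C u w = measure ?U {..w}" unfolding \<mu>(5) s measure_uniform_01_atMost .
    next
      assume "1 \<le> w"
      have "prob ({..u} \<times> {..w}) = prob ({..u} \<times> UNIV)"
        using one'[OF \<open>1 \<le> w\<close>] by (intro finite_measure_eq_AE) (auto simp: ev)
      then show "C u w = measure ?U {..u}" unfolding \<mu>(5) f measure_uniform_01_atMost .
    qed
  qed
  show ?thesis
  proof (intro ext)
    fix u w :: real
    consider "u \<le> 0" | "w \<le> 0" | "1 \<le> u" | "1 \<le> w" | "0 < u" "u < 1" "0 < w" "w < 1" by linarith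
    then show "C1 u w = C2 u w"
      using bd[OF C1, of u w] bd[OF C2, of u w] by cases (simp_all add: eq)
  qed
qed

text \<open>The definite description in \<open>copula_of\<close> is met by the joint distribution function of the two uniformized variables, and
  by nothing else.\<close>

lemma (in prob_space) copula_of_eq:
  assumes [measurable]: "X \<in> borel_measurable M" "Z \<in> borel_measurable M"
    and contX: "\<And>z. isCont (cdf (distr M borel X)) z"
    and contZ: "\<And>z. isCont (cdf (distr M borel Z)) z"
  shows "copula_of M X Z u w = prob {\<omega>\<in>space M. cdf_transform M X \<omega> \<le> u \<and> cdf_transform M Z \<omega> \<le> w}"
proof -
  let ?U = "cdf_transform M X" and ?W = "cdf_transform M Z"
  let ?C = "\<lambda>u w. prob {\<omega>\<in>space M. ?U \<omega> \<le> u \<and> ?W \<omega> \<le> w}"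
  interpret X: real_distribution "distr M borel X" by simp
  interpret Z: real_distribution "distr M borel Z" by simp
  have cop: "is_copula ?C"
    unfolding is_copula_def
  proof (intro exI conjI allI)
    let ?\<mu> = "distr M borel (\<lambda>\<omega>. (?U \<omega>, ?W \<omega>))"
    note [measurable] = measurable_fst_borel measurable_snd_borel
    show "prob_space ?\<mu>" by (intro prob_space_distr) simp
    show "sets ?\<mu> = sets borel" by simp
    show "distr ?\<mu> borel fst = uniform_measure lborel {0..1}"
      using distr_cdf_transform[OF _ contX] by (subst distr_distr) (auto simp: comp_def)
    show "distr ?\<mu> borel snd = uniform_measure lborel {0..1}"
      using distr_cdf_transform[OF _ contZ] by (subst distr_distr) (auto simp: comp_def)
    fix u w :: real
    show "?C u w = measure ?\<mu> ({..u} \<times> {..w})"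
      by (subst measure_distr) (auto intro!: borel_closed closed_Times arg_cong[where f=prob])
  qed
  have rng: "prob {\<omega>\<in>space M. X \<omega> \<le> x \<and> Z \<omega> \<le> z} = ?C (cdf (distr M borel X) x) (cdf (distr M borel Z) z)" for x z
    using AE_cdf_transform_le_iff[OF assms(1) contX, of x] AE_cdf_transform_le_iff[OF assms(2) contZ, of z]
    by (intro finite_measure_eq_AE) auto
  have "copula_of M X Z = ?C"
    unfolding copula_of_def
  proof (rule the_equality)
    show "is_copula ?C \<and> (\<forall>x z. prob {\<omega>\<in>space M. X \<omega> \<le> x \<and> Z \<omega> \<le> z} = ?C (cdf (distr M borel X) x) (cdf (distr M borel Z) z))"
      using cop rng by blast
    fix C assume C: "is_copula C \<and> (\<forall>x z. prob {\<omega>\<in>space M. X \<omega> \<le> x \<and> Z \<omega> \<le> z} = C (cdf (distr M borel X) x) (cdf (distr M borel Z) z))"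
    show "C = ?C"
    proof (rule is_copula_eqI)
      fix u w :: real assume uw: "0 < u" "u < 1" "0 < w" "w < 1"
      obtain x where x: "cdf (distr M borel X) x = u"
        using X.cdf_attains[OF contX uw(1,2)] by blast
      obtain z where z: "cdf (distr M borel Z) z = w"
        using Z.cdf_attains[OF contZ uw(3,4)] by blast
      have "C (cdf (distr M borel X) x) (cdf (distr M borel Z) z) = ?C (cdf (distr M borel X) x) (cdf (distr M borel Z) z)"
        using C rng[of x z] by simp
      then show "C u w = ?C u w" unfolding x z .
    qed (use C cop in auto)
  qed
  then show ?thesis by simp
qed

text \<open>In the first argument only the values \<open>F\<^sub>X(x)\<close> occur in the theorem. There the transformation of \<open>X\<close> can be undone,
  so that \<open>v \<mapsto> C(F\<^sub>X(x), v)\<close> is the distribution function of \<open>F\<^sub>Z(Z)\<close> restricted to \<open>{X \<le> x}\<close>.\<close>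

lemma (in prob_space) copula_of_cdf:
  assumes [measurable]: "X \<in> borel_measurable M" "Z \<in> borel_measurable M"
    and contX: "\<And>z. isCont (cdf (distr M borel X)) z"
    and contZ: "\<And>z. isCont (cdf (distr M borel Z)) z"
  shows "copula_of M X Z (cdf (distr M borel X) x) w = prob {\<omega>\<in>space M. X \<omega> \<le> x \<and> cdf_transform M Z \<omega> \<le> w}"
  unfolding copula_of_eq[OF assms]
  using AE_cdf_transform_le_iff[OF assms(1) contX, of x]
  by (intro finite_measure_eq_AE) auto

section \<open>Conditional probabilities given a uniform variable\<close>

text \<open>A version of \<open>w \<mapsto> P(A | W = w)\<close> that takes values in \<open>[0, 1]\<close> at every point, not just almost everywhere; products of such
  versions are then bounded and integrable without further argument.\<close>

definition cond_prob_version :: "'a measure \<Rightarrow> ('a \<Rightarrow> real) \<Rightarrow> 'a set \<Rightarrow> (real \<Rightarrow> real) \<Rightarrow> bool" where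
  "cond_prob_version M W A \<phi> \<longleftrightarrow> \<phi> \<in> borel_measurable borel \<and> (\<forall>w. 0 \<le> \<phi> w \<and> \<phi> w \<le> 1) \<and>
     (\<forall>g\<in>borel_measurable borel.
        (\<integral>\<^sup>+\<omega>. indicator A \<omega> * g (W \<omega>) \<partial>M) = (\<integral>\<^sup>+\<omega>. ennreal (\<phi> (W \<omega>)) * g (W \<omega>) \<partial>M))"

lemma cond_prob_versionD:
  assumes "cond_prob_version M W A \<phi>"
  shows "\<phi> \<in> borel_measurable borel" "\<And>w. 0 \<le> \<phi> w" "\<And>w. \<phi> w \<le> 1"
    "\<And>g. g \<in> borel_measurable borel \<Longrightarrow>
        (\<integral>\<^sup>+\<omega>. indicator A \<omega> * g (W \<omega>) \<partial>M) = (\<integral>\<^sup>+\<omega>. ennreal (\<phi> (W \<omega>)) * g (W \<omega>) \<partial>M)"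
  using assms unfolding cond_prob_version_def by auto

text \<open>A Radon-Nikodym derivative of \<open>B \<mapsto> P(A \<inter> {W \<in> B})\<close> with respect to the law of \<open>W\<close>. Since that measure is dominated by
  the law of \<open>W\<close>, the derivative is at most 1 almost everywhere, and truncating it changes nothing.\<close>

lemma (in prob_space) ex_cond_prob_version:
  assumes [measurable]: "W \<in> borel_measurable M" "A \<in> events"
  shows "\<exists>\<phi>. cond_prob_version M W A \<phi>"
proof -
  let ?\<mu> = "distr M borel W" and ?\<nu> = "distr (density M (indicator A)) borel W"
  interpret \<mu>: prob_space ?\<mu> by (rule prob_space_distr) simp
  have \<nu>: "emeasure ?\<nu> B = emeasure M (A \<inter> (W -` B \<inter> space M))" if [measurable]: "B \<in> sets borel" for B
  proof -
    have "emeasure ?\<nu> B = (\<integral>\<^sup>+\<omega>. indicator A \<omega> * indicator (W -` B \<inter> space M) \<omega> \<partial>M)"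
      by (simp add: emeasure_distr emeasure_density)
    also have "\<dots> = (\<integral>\<^sup>+\<omega>. indicator (A \<inter> (W -` B \<inter> space M)) \<omega> \<partial>M)"
      by (intro nn_integral_cong) (auto simp: indicator_def)
    finally show ?thesis by simp
  qed
  have le: "emeasure ?\<nu> B \<le> emeasure ?\<mu> B" if [measurable]: "B \<in> sets borel" for B
    unfolding \<nu>[OF that] by (subst emeasure_distr) (auto intro!: emeasure_mono)
  have "absolutely_continuous ?\<mu> ?\<nu>"
    unfolding absolutely_continuous_def
  proof
    fix B assume "B \<in> null_sets ?\<mu>"
    then have B: "emeasure ?\<mu> B = 0" "B \<in> sets borel" by auto
    then show "B \<in> null_sets ?\<nu>" using le[OF B(2)] by auto
  qed
  then obtain f where f[measurable]: "f \<in> borel_measurable borel" and df: "density ?\<mu> f = ?\<nu>"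
    using \<mu>.Radon_Nikodym[of ?\<nu>] by auto
  have f1: "AE w in ?\<mu>. f w \<le> 1"
  proof -
    let ?B = "{w. 1 < f w}"
    have B: "?B \<in> sets borel" by simp
    have "(\<integral>\<^sup>+w. f w * indicator ?B w \<partial>?\<mu>) = emeasure ?\<nu> ?B"
      unfolding df[symmetric] by (subst emeasure_density) auto
    also have "\<dots> \<le> (\<integral>\<^sup>+w. indicator ?B w \<partial>?\<mu>)" using le[OF B] by simp
    finally have leB: "(\<integral>\<^sup>+w. f w * indicator ?B w \<partial>?\<mu>) \<le> (\<integral>\<^sup>+w. indicator ?B w \<partial>?\<mu>)" .
    moreover have "(\<integral>\<^sup>+w. indicator ?B w \<partial>?\<mu>) < \<top>"
      by (simp add: \<mu>.emeasure_eq_measure)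
    ultimately have "(\<integral>\<^sup>+w. f w * indicator ?B w \<partial>?\<mu>) - (\<integral>\<^sup>+w. indicator ?B w \<partial>?\<mu>) = 0"
      by (metis diff_eq_0_iff_ennreal le_less_trans)
    moreover have "(\<integral>\<^sup>+w. f w * indicator ?B w - indicator ?B w \<partial>?\<mu>)
        = (\<integral>\<^sup>+w. f w * indicator ?B w \<partial>?\<mu>) - (\<integral>\<^sup>+w. indicator ?B w \<partial>?\<mu>)"
    proof (rule nn_integral_diff)
      show "AE w in ?\<mu>. indicator ?B w \<le> f w * indicator ?B w"
        by (intro always_eventually allI) (auto simp: indicator_def less_imp_le)
    qed (auto simp: \<mu>.emeasure_finite)
    ultimately have "(\<integral>\<^sup>+w. f w * indicator ?B w - indicator ?B w \<partial>?\<mu>) = 0" by simp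
    then have "AE w in ?\<mu>. f w * indicator ?B w - indicator ?B w = 0"
      by (subst (asm) nn_integral_0_iff_AE) auto
    then show ?thesis
    proof eventually_elim
      case (elim w)
      show ?case
      proof (rule ccontr)
        assume "\<not> f w \<le> 1"
        then have "f w - 1 = 0" "1 < f w" using elim by (simp_all add: indicator_def not_le)
        then show False by (metis diff_gt_0_iff_gt_ennreal less_irrefl)
      qed
    qed
  qed
  define \<phi> where "\<phi> w = enn2real (min 1 (f w))" for w
  have \<phi>: "ennreal (\<phi> w) = min 1 (f w)" for w
    unfolding \<phi>_def by (rule ennreal_enn2real) (simp add: min_less_iff_disj)
  have [measurable]: "\<phi> \<in> borel_measurable borel" unfolding \<phi>_def by measurable
  show ?thesis
    unfolding cond_prob_version_def
  proof (intro exI[of _ \<phi>] conjI allI ballI)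
    fix w
    show "0 \<le> \<phi> w" by (simp add: \<phi>_def)
    have "ennreal (\<phi> w) \<le> ennreal 1" unfolding \<phi> by simp
    then show "\<phi> w \<le> 1" by (simp add: ennreal_le_iff2)
  next
    fix g :: "real \<Rightarrow> ennreal" assume [measurable]: "g \<in> borel_measurable borel"
    have "(\<integral>\<^sup>+\<omega>. indicator A \<omega> * g (W \<omega>) \<partial>M) = (\<integral>\<^sup>+w. g w \<partial>?\<nu>)"
      by (subst nn_integral_distr) (auto simp: nn_integral_density)
    also have "\<dots> = (\<integral>\<^sup>+w. f w * g w \<partial>?\<mu>)"
      unfolding df[symmetric] by (subst nn_integral_density) auto
    also have "\<dots> = (\<integral>\<^sup>+w. ennreal (\<phi> w) * g w \<partial>?\<mu>)"
      using f1 by (intro nn_integral_cong_AE) (auto simp: \<phi> min_def)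
    also have "\<dots> = (\<integral>\<^sup>+\<omega>. ennreal (\<phi> (W \<omega>)) * g (W \<omega>) \<partial>M)"
      by (subst nn_integral_distr) auto
    finally show "(\<integral>\<^sup>+\<omega>. indicator A \<omega> * g (W \<omega>) \<partial>M) = (\<integral>\<^sup>+\<omega>. ennreal (\<phi> (W \<omega>)) * g (W \<omega>) \<partial>M)" .
  qed simp
qed

text \<open>Conditioning on \<open>Z = z\<close> is conditioning on \<open>F\<^sub>Z(Z) = F\<^sub>Z(z)\<close>: both sides are densities of the same finite measure on the
  line, because the two measures agree on all half-lines.\<close>

lemma (in prob_space) prob_given_eq_cond_prob_version:
  assumes [measurable]: "Z \<in> borel_measurable M" "A \<in> events"
    and cont: "\<And>z. isCont (cdf (distr M borel Z)) z"
    and \<phi>: "cond_prob_version M (cdf_transform M Z) A \<phi>"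
  shows "AE z in distr M borel Z. prob_given M Z A z = \<phi> (cdf (distr M borel Z) z)"
proof -
  let ?\<mu> = "distr M borel Z" and ?\<nu> = "distr (density M (indicator A)) borel Z"
  let ?F = "cdf ?\<mu>" and ?W = "cdf_transform M Z"
  note \<phi> = cond_prob_versionD[OF \<phi>]
  note [measurable] = \<phi>(1)
  interpret \<mu>: prob_space ?\<mu> by (rule prob_space_distr) simp
  let ?\<nu>' = "density ?\<mu> (\<lambda>z. ennreal (\<phi> (?F z)))"
  have e1: "emeasure ?\<nu> {..z} = (\<integral>\<^sup>+\<omega>. indicator A \<omega> * indicator {\<omega>. Z \<omega> \<le> z} \<omega> \<partial>M)" for z
    by (simp add: emeasure_distr emeasure_density)
       (intro nn_integral_cong, auto simp: indicator_def)
  have e2: "emeasure ?\<nu>' {..z} = (\<integral>\<^sup>+\<omega>. ennreal (\<phi> (?W \<omega>)) * indicator {\<omega>. Z \<omega> \<le> z} \<omega> \<partial>M)" for z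
    by (subst emeasure_density, simp, simp, subst nn_integral_distr)
       (auto intro!: nn_integral_cong simp: indicator_def cdf_transform_def)
  have eq: "emeasure ?\<nu> {..z} = emeasure ?\<nu>' {..z}" for z
  proof -
    note ae = AE_cdf_transform_le_iff[OF assms(1) cont, of z]
    have "emeasure ?\<nu> {..z} = (\<integral>\<^sup>+\<omega>. indicator A \<omega> * indicator {..?F z} (?W \<omega>) \<partial>M)"
      unfolding e1 using ae by (intro nn_integral_cong_AE) (auto simp: indicator_def)
    also have "\<dots> = (\<integral>\<^sup>+\<omega>. ennreal (\<phi> (?W \<omega>)) * indicator {..?F z} (?W \<omega>) \<partial>M)"
      by (rule \<phi>(4)) simp
    also have "\<dots> = emeasure ?\<nu>' {..z}"
      unfolding e2 using ae by (intro nn_integral_cong_AE) (auto simp: indicator_def)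
    finally show ?thesis .
  qed
  have fin1: "finite_measure ?\<nu>"
  proof
    have "emeasure ?\<nu> (space ?\<nu>) \<le> (\<integral>\<^sup>+\<omega>. 1 \<partial>M)"
      by (simp add: emeasure_distr emeasure_density emeasure_space)
    then show "emeasure ?\<nu> (space ?\<nu>) \<noteq> \<infinity>" by (auto simp: emeasure_space_1 top_unique)
  qed
  have fin2: "finite_measure ?\<nu>'"
  proof
    have "emeasure ?\<nu>' (space ?\<nu>') \<le> (\<integral>\<^sup>+\<omega>. 1 \<partial>?\<mu>)"
      using \<phi>(3) by (subst emeasure_density, simp, simp, intro nn_integral_mono) (simp add: indicator_def)
    then show "emeasure ?\<nu>' (space ?\<nu>') \<noteq> \<infinity>" using \<mu>.emeasure_space_1 by (auto simp: top_unique)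
  qed
  have "?\<nu>' = ?\<nu>"
  proof (rule cdf_unique')
    show "finite_borel_measure ?\<nu>'" "finite_borel_measure ?\<nu>"
      using fin1 fin2 by (auto simp: finite_borel_measure_def finite_borel_measure_axioms_def)
    show "cdf ?\<nu>' = cdf ?\<nu>" by (intro ext) (simp add: cdf_def measure_def eq)
  qed
  then have "AE z in ?\<mu>. ennreal (\<phi> (?F z)) = RN_deriv ?\<mu> ?\<nu> z"
    by (intro \<mu>.RN_deriv_unique) simp_all
  then show ?thesis
    unfolding prob_given_def
  proof eventually_elim
    case (elim z)
    show ?case unfolding elim[symmetric] using \<phi>(2) by simp
  qed
qed

text \<open>Conditional independence, integrated over the law of \<open>Z\<close> and rewritten in terms of \<open>F\<^sub>Z(Z)\<close>.\<close>

lemma (in prob_space) emeasure_atMost_product: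
  fixes X :: "'i \<Rightarrow> 'a \<Rightarrow> real"
  assumes I: "finite I" and X[measurable]: "\<And>i. i \<in> I \<Longrightarrow> X i \<in> borel_measurable M"
    and Z[measurable]: "Z \<in> borel_measurable M" and cont: "\<And>z. isCont (cdf (distr M borel Z)) z"
    and ci: "cond_indep_given M X I Z"
    and \<psi>: "\<And>i S. i \<in> I \<Longrightarrow> S \<in> sets borel \<Longrightarrow> cond_prob_version M (cdf_transform M Z) {\<omega>\<in>space M. X i \<omega> \<in> S} (\<psi> i S)"
  shows "emeasure M {\<omega>\<in>space M. \<forall>i\<in>I. X i \<omega> \<in> {..x i}}
    = (\<integral>\<^sup>+\<omega>. ennreal (\<Prod>i\<in>I. \<psi> i {..x i} (cdf_transform M Z \<omega>)) \<partial>M)"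
proof -
  let ?\<mu> = "distr M borel Z" and ?W = "cdf_transform M Z"
  let ?F = "cdf ?\<mu>"
  let ?A = "{\<omega>\<in>space M. \<forall>i\<in>I. X i \<omega> \<in> {..x i}}"
  have A[measurable]: "?A \<in> events" using I by measurable
  obtain \<phi> where \<phi>: "cond_prob_version M ?W ?A \<phi>"
    using ex_cond_prob_version[OF measurable_cdf_transform[OF Z] A] by blast
  note [measurable] = cond_prob_versionD(1)[OF \<phi>] cond_prob_versionD(1)[OF \<psi>]
  have "AE z in ?\<mu>. prob_given M Z ?A z = (\<Prod>i\<in>I. prob_given M Z {\<omega>\<in>space M. X i \<omega> \<in> {..x i}} z)"
    using ci unfolding cond_indep_given_def by (simp add: atMost_iff)
  moreover have "AE z in ?\<mu>. prob_given M Z ?A z = \<phi> (?F z)"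
    by (rule prob_given_eq_cond_prob_version[OF Z A cont \<phi>])
  moreover have "AE z in ?\<mu>. \<forall>i\<in>I. prob_given M Z {\<omega>\<in>space M. X i \<omega> \<in> {..x i}} z = \<psi> i {..x i} (?F z)"
    using I by (intro AE_finite_allI prob_given_eq_cond_prob_version cont \<psi>) auto
  ultimately have ae: "AE z in ?\<mu>. \<phi> (?F z) = (\<Prod>i\<in>I. \<psi> i {..x i} (?F z))"
    by eventually_elim simp
  have "emeasure M ?A = (\<integral>\<^sup>+\<omega>. indicator ?A \<omega> * 1 \<partial>M)"
    by (simp only: mult_1_right nn_integral_indicator[OF A])
  also have "\<dots> = (\<integral>\<^sup>+\<omega>. ennreal (\<phi> (?W \<omega>)) * 1 \<partial>M)"
    by (rule cond_prob_versionD(4)[OF \<phi>]) simp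
  also have "\<dots> = (\<integral>\<^sup>+z. ennreal (\<phi> (?F z)) \<partial>?\<mu>)"
    by (subst nn_integral_distr) (auto simp: cdf_transform_def)
  also have "\<dots> = (\<integral>\<^sup>+z. ennreal (\<Prod>i\<in>I. \<psi> i {..x i} (?F z)) \<partial>?\<mu>)"
    using ae by (intro nn_integral_cong_AE) auto
  also have "\<dots> = (\<integral>\<^sup>+\<omega>. ennreal (\<Prod>i\<in>I. \<psi> i {..x i} (?W \<omega>)) \<partial>M)"
    by (subst nn_integral_distr) (auto simp: cdf_transform_def)
  finally show ?thesis .
qed

text \<open>From half-lines to Borel sets, one coordinate at a time. When the sets in the other coordinates are fixed, both sides are finite
  measures in the remaining set \<open>B\<close>: the right-hand side is so because \<open>E(1\<^bsub>{X \<in> B}\<^esub> G(W)) = E(\<psi>\<^sub>B(W) G(W))\<close>. They agree on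
  half-lines by the induction hypothesis, hence everywhere.\<close>

lemma (in prob_space) emeasure_borel_product:
  fixes X :: "'i \<Rightarrow> 'a \<Rightarrow> real"
  assumes I: "finite I" and X[measurable]: "\<And>i. i \<in> I \<Longrightarrow> X i \<in> borel_measurable M"
    and W[measurable]: "W \<in> borel_measurable M"
    and \<psi>: "\<And>i S. i \<in> I \<Longrightarrow> S \<in> sets borel \<Longrightarrow> cond_prob_version M W {\<omega>\<in>space M. X i \<omega> \<in> S} (\<psi> i S)"
    and atMost: "\<And>x. emeasure M {\<omega>\<in>space M. \<forall>i\<in>I. X i \<omega> \<in> {..x i}}
        = (\<integral>\<^sup>+\<omega>. ennreal (\<Prod>i\<in>I. \<psi> i {..x i} (W \<omega>)) \<partial>M)"
    and S: "\<And>i. i \<in> I \<Longrightarrow> S i \<in> sets borel"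
  shows "emeasure M {\<omega>\<in>space M. \<forall>i\<in>I. X i \<omega> \<in> S i} = (\<integral>\<^sup>+\<omega>. ennreal (\<Prod>i\<in>I. \<psi> i (S i) (W \<omega>)) \<partial>M)"
proof -
  let ?P = "\<lambda>S. emeasure M {\<omega>\<in>space M. \<forall>i\<in>I. X i \<omega> \<in> S i} = (\<integral>\<^sup>+\<omega>. ennreal (\<Prod>i\<in>I. \<psi> i (S i) (W \<omega>)) \<partial>M)"
  have "?P S" if "finite J" "J \<subseteq> I" "\<And>i. i \<in> J \<Longrightarrow> S i \<in> sets borel" "\<And>i. i \<in> I - J \<Longrightarrow> S i \<in> range atMost" for J S
    using that
  proof (induction J arbitrary: S rule: finite_induct)
    case empty
    then have "\<forall>i\<in>I. \<exists>x. S i = {..x}" by auto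
    then obtain x where x: "\<And>i. i \<in> I \<Longrightarrow> S i = {..x i}" by metis
    show ?case using atMost[of x] x by (simp cong: ball_cong_simp prod.cong_simp conj_cong)
  next
    case (insert j J)
    have jI: "j \<in> I" using insert.prems by auto
    have Sb: "S i \<in> sets borel" if "i \<in> I" for i
      using insert.prems(2)[of i] insert.prems(3)[of i] that by (cases "i \<in> insert j J") auto
    note [measurable] = X[OF jI]
    have [measurable]: "\<psi> i (S i) \<in> borel_measurable borel" if "i \<in> I" for i
      using cond_prob_versionD(1)[OF \<psi>] Sb that by auto
    (* A and G collect the coordinates other than j; ?N1 and ?N2 are the two sides of the
       claim as measures in the set of coordinate j. *)
    define A where "A = {\<omega>\<in>space M. \<forall>i\<in>I - {j}. X i \<omega> \<in> S i}"
    define G where "G w = ennreal (\<Prod>i\<in>I - {j}. \<psi> i (S i) w)" for w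
    have "{\<omega>\<in>space M. X i \<omega> \<in> S i} \<in> events" if "i \<in> I" for i
      using measurable_sets[OF X[OF that] Sb[OF that]] by (simp add: vimage_def Int_def conj_commute)
    then have A[measurable]: "A \<in> events"
      unfolding A_def using I by (intro sets.sets_Collect_finite_All) auto
    have G[measurable]: "G \<in> borel_measurable borel" unfolding G_def by measurable
    let ?N1 = "distr (density M (indicator A)) borel (X j)"
    let ?N2 = "distr (density M (\<lambda>\<omega>. G (W \<omega>))) borel (X j)"
    have N1: "emeasure ?N1 B = emeasure M {\<omega>\<in>space M. \<forall>i\<in>I. X i \<omega> \<in> (S(j := B)) i}"
      if [measurable]: "B \<in> sets borel" for B
    proof -
      have "emeasure ?N1 B = (\<integral>\<^sup>+\<omega>. indicator A \<omega> * indicator (X j -` B \<inter> space M) \<omega> \<partial>M)"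
        by (simp add: emeasure_distr emeasure_density)
      also have "\<dots> = (\<integral>\<^sup>+\<omega>. indicator (A \<inter> (X j -` B \<inter> space M)) \<omega> \<partial>M)"
        by (intro nn_integral_cong) (auto simp: indicator_def)
      also have "\<dots> = emeasure M (A \<inter> (X j -` B \<inter> space M))" by simp
      also have "A \<inter> (X j -` B \<inter> space M) = {\<omega>\<in>space M. \<forall>i\<in>I. X i \<omega> \<in> (S(j := B)) i}"
        unfolding A_def using jI by (auto split: if_splits)
      finally show ?thesis .
    qed
    have N2: "emeasure ?N2 B = (\<integral>\<^sup>+\<omega>. ennreal (\<Prod>i\<in>I. \<psi> i ((S(j := B)) i) (W \<omega>)) \<partial>M)"
      if B[measurable]: "B \<in> sets borel" for B
    proof -
      note v = cond_prob_versionD[OF \<psi>[OF jI B]]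
      have "emeasure ?N2 B = (\<integral>\<^sup>+\<omega>. indicator {\<omega>\<in>space M. X j \<omega> \<in> B} \<omega> * G (W \<omega>) \<partial>M)"
        by (simp add: emeasure_distr emeasure_density) (intro nn_integral_cong, auto simp: indicator_def)
      also have "\<dots> = (\<integral>\<^sup>+\<omega>. ennreal (\<psi> j B (W \<omega>)) * G (W \<omega>) \<partial>M)"
        by (rule v(4)) simp
      also have "\<dots> = (\<integral>\<^sup>+\<omega>. ennreal (\<Prod>i\<in>I. \<psi> i ((S(j := B)) i) (W \<omega>)) \<partial>M)"
      proof (intro nn_integral_cong)
        fix \<omega>
        have "(\<Prod>i\<in>I. \<psi> i ((S(j := B)) i) (W \<omega>)) = \<psi> j B (W \<omega>) * (\<Prod>i\<in>I - {j}. \<psi> i (S i) (W \<omega>))"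
          using I jI by (subst prod.remove[of I j]) (auto intro!: prod.cong)
        then show "ennreal (\<psi> j B (W \<omega>)) * G (W \<omega>) = ennreal (\<Prod>i\<in>I. \<psi> i ((S(j := B)) i) (W \<omega>))"
          unfolding G_def using v(2) by (simp add: ennreal_mult')
      qed
      finally show ?thesis .
    qed
    have eq: "emeasure ?N1 {..t} = emeasure ?N2 {..t}" for t
    proof -
      have "?P (S(j := {..t}))"
        using insert.prems insert.hyps by (intro insert.IH) auto
      then show ?thesis by (subst N1, simp, subst N2, simp)
    qed
    have fin: "finite_measure ?N1" "finite_measure ?N2"
    proof -
      have "G (W \<omega>) \<le> 1" for \<omega>
        unfolding G_def using Sb cond_prob_versionD(2,3)[OF \<psi>]
        by (auto intro!: prod_le_1 simp: ennreal_le_1)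
      then have "(\<integral>\<^sup>+\<omega>. G (W \<omega>) \<partial>M) \<le> (\<integral>\<^sup>+\<omega>. 1 \<partial>M)" by (intro nn_integral_mono)
      moreover have "(\<integral>\<^sup>+\<omega>. indicator A \<omega> \<partial>M) \<le> (\<integral>\<^sup>+\<omega>. 1 \<partial>M)"
        by (intro nn_integral_mono) (auto simp: indicator_def)
      moreover have "emeasure ?N1 (space ?N1) = (\<integral>\<^sup>+\<omega>. indicator A \<omega> \<partial>M)"
        "emeasure ?N2 (space ?N2) = (\<integral>\<^sup>+\<omega>. G (W \<omega>) \<partial>M)"
        by (auto simp: emeasure_distr emeasure_density intro!: nn_integral_cong)
      ultimately show "finite_measure ?N1" "finite_measure ?N2"
        by (auto intro!: finite_measureI simp: emeasure_space_1 top_unique)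
    qed
    have "?N1 = ?N2"
    proof (rule cdf_unique')
      show "finite_borel_measure ?N1" "finite_borel_measure ?N2"
        using fin by (auto simp: finite_borel_measure_def finite_borel_measure_axioms_def)
      show "cdf ?N1 = cdf ?N2" by (intro ext) (simp add: cdf_def measure_def eq)
    qed
    then have "emeasure ?N1 (S j) = emeasure ?N2 (S j)" by simp
    then show ?case unfolding N1[OF Sb[OF jI]] N2[OF Sb[OF jI]] by simp
  qed
  from this[of I S] show ?thesis using I S by auto
qed

text \<open>Differentiating in the uniform variable recovers the conditional probability, since \<open>P(A \<inter> {c < W \<le> d})\<close> is the integral of
  \<open>\<phi>\<close> over \<open>[c, d]\<close>.\<close>

lemma (in prob_space) AE_deriv_cond_prob_version:
  assumes [measurable]: "W \<in> borel_measurable M" "A \<in> events"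
    and U: "distr M borel W = uniform_measure lborel {0..1}"
    and \<phi>: "cond_prob_version M W A \<phi>"
  shows "AE w in lebesgue. w \<in> {0<..<1} \<longrightarrow>
    ((\<lambda>v. prob {\<omega>\<in>A. W \<omega> \<le> v}) has_real_derivative \<phi> w) (at w)"
proof (rule AE_lebesgue_differentiation)
  note \<phi> = cond_prob_versionD[OF \<phi>]
  note [measurable] = \<phi>(1)
  show "\<phi> \<in> borel_measurable borel" "\<And>t. 0 \<le> \<phi> t" "\<And>t. \<phi> t \<le> 1" by (fact \<phi>)+
  fix c d :: real assume cd: "0 < c" "c < d" "d < 1"
  have ev[measurable]: "{\<omega>\<in>A. W \<omega> \<le> v} \<in> events" for v
  proof -
    have "{\<omega>\<in>A. W \<omega> \<le> v} = A \<inter> {\<omega>\<in>space M. W \<omega> \<le> v}" using sets.sets_into_space[OF assms(2)] by auto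
    then show ?thesis by simp
  qed
  have "prob {\<omega>\<in>A. W \<omega> \<le> d} - prob {\<omega>\<in>A. W \<omega> \<le> c} = prob ({\<omega>\<in>A. W \<omega> \<le> d} - {\<omega>\<in>A. W \<omega> \<le> c})"
    using cd by (intro finite_measure_Diff[symmetric] ev) auto
  also have "ennreal \<dots> = (\<integral>\<^sup>+\<omega>. indicator ({\<omega>\<in>A. W \<omega> \<le> d} - {\<omega>\<in>A. W \<omega> \<le> c}) \<omega> \<partial>M)"
    by (subst nn_integral_indicator) (auto simp: emeasure_eq_measure)
  also have "\<dots> = (\<integral>\<^sup>+\<omega>. indicator A \<omega> * indicator {c<..d} (W \<omega>) \<partial>M)"
    by (intro nn_integral_cong) (auto simp: indicator_def)
  also have "\<dots> = (\<integral>\<^sup>+\<omega>. ennreal (\<phi> (W \<omega>)) * indicator {c<..d} (W \<omega>) \<partial>M)"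
    by (rule \<phi>(4)) simp
  also have "\<dots> = (\<integral>\<^sup>+w. ennreal (\<phi> w) * indicator {c<..d} w \<partial>distr M borel W)"
    by (subst nn_integral_distr) auto
  also have "\<dots> = (\<integral>\<^sup>+w. ennreal (\<phi> w) * indicator {c<..d} w * indicator {0..1} w \<partial>lborel)"
    unfolding U by (subst nn_integral_uniform_measure) (auto simp: divide_ennreal_def)
  also have "\<dots> = (\<integral>\<^sup>+w. ennreal (\<phi> w) * indicator {c..d} w \<partial>lborel)"
    using AE_lborel_singleton[of c] cd by (intro nn_integral_cong_AE) (auto simp: indicator_def)
  also have "\<dots> = ennreal (LBINT t:{c..d}. \<phi> t)"
    by (rule nn_integral_Icc_bounded) (use \<phi> in auto)
  finally have "ennreal (prob {\<omega>\<in>A. W \<omega> \<le> d} - prob {\<omega>\<in>A. W \<omega> \<le> c}) = ennreal (LBINT t:{c..d}. \<phi> t)" .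
  moreover have "prob {\<omega>\<in>A. W \<omega> \<le> c} \<le> prob {\<omega>\<in>A. W \<omega> \<le> d}"
    using cd by (intro finite_measure_mono ev) auto
  moreover have "0 \<le> (LBINT t:{c..d}. \<phi> t)"
    unfolding set_lebesgue_integral_def using \<phi>(2) by (intro integral_nonneg_AE) auto
  ultimately show "prob {\<omega>\<in>A. W \<omega> \<le> d} - prob {\<omega>\<in>A. W \<omega> \<le> c} = (LBINT t:{c..d}. \<phi> t)"
    by simp
qed

text \<open>The entries of the matrices are derivatives that agree with Borel functions only almost everywhere, so they are measurable for the
  completed measure; this lemma moves their integrals to Borel functions.\<close>

lemma lebesgue_integral_AE_eq_lborel:
  fixes h k :: "real \<Rightarrow> real"
  assumes h[measurable]: "h \<in> borel_measurable borel" and h0: "\<And>w. 0 \<le> h w" and h1: "\<And>w. h w \<le> 1"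
    and ae: "AE w in lebesgue. w \<in> {0<..<1} \<longrightarrow> k w = h w"
  shows "set_integrable lebesgue {0..1} k" "(LINT w:{0..1}|lebesgue. k w) = (LINT w:{0..1}|lborel. h w)"
proof -
  have "AE w in lebesgue. w \<noteq> (0::real)" "AE w in lebesgue. w \<noteq> (1::real)"
    using AE_lborel_singleton by (auto intro: AE_completion)
  then have ae': "AE w in lebesgue. indicator {0..1} w *\<^sub>R h w = indicator {0..1} w *\<^sub>R k w"
    using ae by eventually_elim (auto simp: indicator_def)
  have mh: "(\<lambda>w. indicator {0..1} w *\<^sub>R h w) \<in> borel_measurable lborel" by measurable
  then have mh': "(\<lambda>w. indicator {0..1} w *\<^sub>R h w) \<in> borel_measurable lebesgue" by (rule measurable_completion)
  have mk: "(\<lambda>w. indicator {0..1} w *\<^sub>R k w) \<in> borel_measurable lebesgue"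
    by (rule borel_measurable_AE[OF mh' ae'])
  have "integrable lebesgue (\<lambda>w. indicator {0..1} w *\<^sub>R h w)"
    using set_integrable_Icc_bounded[OF assms(1-3)] unfolding set_integrable_def integrable_completion[OF mh] .
  then show "set_integrable lebesgue {0..1} k"
    unfolding set_integrable_def using integrable_cong_AE[OF mh' mk ae'] by simp
  show "(LINT w:{0..1}|lebesgue. k w) = (LINT w:{0..1}|lborel. h w)"
    unfolding set_lebesgue_integral_def integral_completion[OF mh, symmetric]
    using integral_cong_AE[OF mh' mk ae'] by simp
qed

lemma nn_integral_uniform_transform:
  fixes h :: "real \<Rightarrow> real"
  assumes W[measurable]: "W \<in> borel_measurable M"
    and U: "distr M borel W = uniform_measure lborel {0..1}"
    and h[measurable]: "h \<in> borel_measurable borel" and h0: "\<And>w. 0 \<le> h w" and h1: "\<And>w. h w \<le> 1"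
  shows "(\<integral>\<^sup>+\<omega>. ennreal (h (W \<omega>)) \<partial>M) = ennreal (LINT w:{0..1}|lborel. h w)"
proof -
  have "(\<integral>\<^sup>+\<omega>. ennreal (h (W \<omega>)) \<partial>M) = (\<integral>\<^sup>+w. ennreal (h w) \<partial>distr M borel W)"
    by (subst nn_integral_distr) auto
  also have "\<dots> = (\<integral>\<^sup>+w. ennreal (h w) * indicator {0..1} w \<partial>lborel)"
    unfolding U by (subst nn_integral_uniform_measure) (auto simp: divide_ennreal_def)
  also have "\<dots> = ennreal (LINT w:{0..1}|lborel. h w)"
    by (rule nn_integral_Icc_bounded) (use assms in auto)
  finally show ?thesis .
qed

section \<open>Bins and the entries of the block rows\<close>

text \<open>Written as a difference of nested sets, so that its probability is a difference of values of distribution functions, as the entries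
  of the matrix are. The \<open>k + 1\<close> bins partition the line when \<open>x\<close> is increasing.\<close>

definition bin :: "nat \<Rightarrow> (nat \<Rightarrow> real) \<Rightarrow> nat \<Rightarrow> real set" where
  "bin k x p = (if p \<le> k then {..x p} else UNIV) - (if p = 1 then {} else {..x (p - 1)})"

text \<open>Written as a difference of nested sets, so that its probability is a difference of values of distribution functions, as the entries
  of the matrix are. The \<open>k + 1\<close> bins partition the line when \<open>x\<close> is increasing.\<close>

definition bin_of :: "nat \<Rightarrow> (nat \<Rightarrow> real) \<Rightarrow> real \<Rightarrow> nat" where
  "bin_of k x t = (LEAST p. 1 \<le> p \<and> (p \<le> k \<longrightarrow> t \<le> x p))"

lemma bin_borel[measurable]: "bin k x p \<in> sets borel"
  unfolding bin_def by auto

lemma bin_of_props: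
  shows bin_of_range: "bin_of k x t \<in> {1..k+1}" and bin_of_le: "bin_of k x t \<le> k \<Longrightarrow> t \<le> x (bin_of k x t)"
proof -
  let ?P = "\<lambda>p. 1 \<le> p \<and> (p \<le> k \<longrightarrow> t \<le> x p)"
  have "?P (k + 1)" by simp
  from LeastI[of ?P, OF this] Least_le[of ?P, OF this]
  show "bin_of k x t \<in> {1..k+1}" "bin_of k x t \<le> k \<Longrightarrow> t \<le> x (bin_of k x t)"
    unfolding bin_of_def by auto
qed

lemma bin_of_le_iff:
  assumes x: "strict_mono_on {1..k} x" and p: "p \<in> {1..k}"
  shows "bin_of k x t \<le> p \<longleftrightarrow> t \<le> x p"
proof
  assume le: "bin_of k x t \<le> p"
  have "x (bin_of k x t) \<le> x p"
    using strict_mono_on_imp_mono_on[OF x] bin_of_range[of k x t] p le by (auto simp: mono_on_def)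
  then show "t \<le> x p" using bin_of_le[of k x t] le p by auto
next
  assume "t \<le> x p"
  then show "bin_of k x t \<le> p" unfolding bin_of_def using p by (intro Least_le) auto
qed

lemma mem_bin_iff:
  assumes x: "strict_mono_on {1..k} x" and p: "p \<in> {1..k+1}"
  shows "t \<in> bin k x p \<longleftrightarrow> bin_of k x t = p"
proof -
  have "p \<le> k \<Longrightarrow> t \<le> x p \<longleftrightarrow> bin_of k x t \<le> p"
    using bin_of_le_iff[OF x, of p t] p by auto
  moreover have "p \<noteq> 1 \<Longrightarrow> t \<le> x (p - 1) \<longleftrightarrow> bin_of k x t \<le> p - 1"
  proof -
    assume "p \<noteq> 1"
    then have "p - 1 \<in> {1..k}" using p unfolding atLeastAtMost_iff by linarith
    then show "t \<le> x (p - 1) \<longleftrightarrow> bin_of k x t \<le> p - 1" by (rule bin_of_le_iff[OF x, symmetric])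
  qed
  ultimately show ?thesis
    using bin_of_range[of k x t] p unfolding bin_def by (cases "p \<le> k"; cases "p = 1") auto
qed

text \<open>With \<open>B\<^sub>p\<close> the bin \<open>p\<close>, a row of block \<open>p\<close> lists the conditional probabilities \<open>P(X\<^sub>m \<in> B\<^sub>p | F\<^sub>Z(Z) = w)\<close>. Both are obtained by differentiating
  in \<open>v\<close> the function \<open>H S v = P(X\<^sub>m \<in> S, F\<^sub>Z(Z) \<le> v)\<close>, which is additive in \<open>S\<close>.\<close>

lemma (in prob_space) AE_block_row_eq:
  assumes X[measurable]: "X m \<in> borel_measurable M" and Z[measurable]: "Z \<in> borel_measurable M"
    and contX: "\<And>z. isCont (cdf (distr M borel (X m))) z"
    and contZ: "\<And>z. isCont (cdf (distr M borel Z)) z"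
    and \<psi>: "\<And>S. S \<in> sets borel \<Longrightarrow> cond_prob_version M (cdf_transform M Z) {\<omega>\<in>space M. X m \<omega> \<in> S} (\<psi> S)"
    and k: "1 \<le> k" and p: "p \<in> {1..k+1}" and x: "strict_mono_on {1..k} x"
  shows "AE w in lebesgue. w \<in> {0<..<1} \<longrightarrow> block_row M X Z k x w p m = \<psi> (bin k x p) w"
proof -
  let ?W = "cdf_transform M Z"
  define H where "H S v = prob {\<omega>\<in>{\<omega>\<in>space M. X m \<omega> \<in> S}. ?W \<omega> \<le> v}" for S v
  note U = distr_cdf_transform[OF Z contZ]
  have ev: "{\<omega>\<in>space M. X m \<omega> \<in> S} \<in> events" if "S \<in> sets borel" for S
    using measurable_sets[OF X that] by (simp add: vimage_def Int_def conj_commute)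
  have ev': "{\<omega>\<in>{\<omega>\<in>space M. X m \<omega> \<in> S}. ?W \<omega> \<le> v} \<in> events" if "S \<in> sets borel" for S v
  proof -
    have "{\<omega>\<in>{\<omega>\<in>space M. X m \<omega> \<in> S}. ?W \<omega> \<le> v} = {\<omega>\<in>space M. X m \<omega> \<in> S} \<inter> {\<omega>\<in>space M. ?W \<omega> \<le> v}" by auto
    then show ?thesis using ev[OF that] by simp
  qed
  have D: "copula_dot M (X m) Z (cdf (distr M borel (X m)) y) w = deriv (H {..y}) w" for y w
    unfolding copula_dot_def copula_of_cdf[OF X Z contX contZ] H_def
    by (intro arg_cong[where f="\<lambda>f. deriv f w"] ext arg_cong[where f=prob]) auto
  have diff: "H (T - S) v = H T v - H S v" if "S \<subseteq> T" "S \<in> sets borel" "T \<in> sets borel" for S T v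
  proof -
    have "{\<omega>\<in>{\<omega>\<in>space M. X m \<omega> \<in> T - S}. ?W \<omega> \<le> v}
        = {\<omega>\<in>{\<omega>\<in>space M. X m \<omega> \<in> T}. ?W \<omega> \<le> v} - {\<omega>\<in>{\<omega>\<in>space M. X m \<omega> \<in> S}. ?W \<omega> \<le> v}" by auto
    then show ?thesis
      unfolding H_def using that by (simp only:) (intro finite_measure_Diff ev', auto)
  qed
  have der: "AE w in lebesgue. w \<in> {0<..<1} \<longrightarrow> (H S has_real_derivative \<psi> S w) (at w)"
    if S: "S \<in> sets borel" for S
    unfolding H_def by (rule AE_deriv_cond_prob_version[OF _ ev[OF S] U \<psi>[OF S]]) simp
  (* The derivative of the whole mass supplies the 1 in the last block. *)
  have "cond_prob_version M ?W {\<omega>\<in>space M. X m \<omega> \<in> UNIV} (\<lambda>_. 1)"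
    unfolding cond_prob_version_def by (auto intro!: nn_integral_cong)
  then have derU: "AE w in lebesgue. w \<in> {0<..<1} \<longrightarrow> (H UNIV has_real_derivative 1) (at w)"
    unfolding H_def by (intro AE_deriv_cond_prob_version[OF _ ev U]) auto
  have mono: "x (p - 1) \<le> x p" if "p \<noteq> 1" "p \<le> k"
  proof -
    have "p - 1 \<in> {1..k}" "p \<in> {1..k}" "p - 1 \<le> p" using p that unfolding atLeastAtMost_iff by linarith+
    then show ?thesis by (rule mono_onD[OF strict_mono_on_imp_mono_on[OF x]])
  qed
  have Icc: "{..y::real} \<in> sets borel" for y by simp
  from der[OF bin_borel[of k x p]] der[OF Icc[of "x p"]] der[OF Icc[of "x (p - 1)"]] derU
  show ?thesis
  proof eventually_elim
    case (elim w)
    show ?case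
    proof
      assume w: "w \<in> {0<..<1}"
      have d: "(H (bin k x p) has_real_derivative \<psi> (bin k x p) w) (at w)"
        "(H {..x p} has_real_derivative \<psi> {..x p} w) (at w)"
        "(H {..x (p - 1)} has_real_derivative \<psi> {..x (p - 1)} w) (at w)"
        "(H UNIV has_real_derivative 1) (at w)" using elim w by blast+
      consider "p = 1" | "p \<noteq> 1" "p \<le> k" | "p = k + 1"
        using p unfolding atLeastAtMost_iff by linarith
      then show "block_row M X Z k x w p m = \<psi> (bin k x p) w"
      proof cases
        case 1
        then have "bin k x p = {..x 1}" using k by (simp add: bin_def)
        then show ?thesis using d(1) 1 by (simp add: block_row_def Let_def D DERIV_imp_deriv)
      next
        case 2
        have "H (bin k x p) = (\<lambda>v. H {..x p} v - H {..x (p - 1)} v)"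
          using 2 mono unfolding bin_def by (auto intro!: ext diff)
        with DERIV_diff[OF d(2,3)] d(1) have "\<psi> (bin k x p) w = \<psi> {..x p} w - \<psi> {..x (p - 1)} w"
          by (auto intro: DERIV_unique)
        then show ?thesis using 2 d(2,3) by (simp add: block_row_def Let_def D DERIV_imp_deriv)
      next
        case 3
        have "H (bin k x p) = (\<lambda>v. H UNIV v - H {..x (p - 1)} v)"
          using 3 k unfolding bin_def by (auto intro!: ext diff)
        with DERIV_diff[OF d(4,3)] d(1) have "\<psi> (bin k x p) w = 1 - \<psi> {..x (p - 1)} w"
          by (auto intro: DERIV_unique)
        then show ?thesis using 3 k d(3) by (simp add: block_row_def Let_def D DERIV_imp_deriv)
      qed
    qed
  qed
qed

lemma (in prob_space) prob_bins_eq_integral: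
  assumes X: "\<And>i. i \<in> {1..n} \<Longrightarrow> X i \<in> borel_measurable M" and Z[measurable]: "Z \<in> borel_measurable M"
    and contX: "\<And>i z. i \<in> {1..n} \<Longrightarrow> isCont (cdf (distr M borel (X i))) z"
    and contZ: "\<And>z. isCont (cdf (distr M borel Z)) z"
    and ci: "cond_indep_given M X {1..n} Z"
    and k: "1 \<le> k" and x: "strict_mono_on {1..k} x" and b: "b \<in> {1..n} \<rightarrow> {1..k+1}"
  shows "set_integrable lebesgue {0..1} (\<lambda>w. \<Prod>m=1..n. block_row M X Z k x w (b m) m)" (is ?int)
    and "prob {\<omega>\<in>space M. \<forall>i\<in>{1..n}. X i \<omega> \<in> bin k x (b i)}
      = (LINT w:{0..1}|lebesgue. \<Prod>m=1..n. block_row M X Z k x w (b m) m)" (is ?eq)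
proof -
  let ?W = "cdf_transform M Z"
  have ev: "{\<omega>\<in>space M. X i \<omega> \<in> S} \<in> events" if "i \<in> {1..n}" "S \<in> sets borel" for i S
    using measurable_sets[OF X[OF that(1)] that(2)] by (simp add: vimage_def Int_def conj_commute)
  define \<psi> where "\<psi> i S = (SOME \<phi>. cond_prob_version M ?W {\<omega>\<in>space M. X i \<omega> \<in> S} \<phi>)" for i S
  have \<psi>: "cond_prob_version M ?W {\<omega>\<in>space M. X i \<omega> \<in> S} (\<psi> i S)" if "i \<in> {1..n}" "S \<in> sets borel" for i S
    unfolding \<psi>_def using ex_cond_prob_version[OF measurable_cdf_transform[OF Z] ev[OF that]] by (rule someI_ex)
  note \<psi>D = cond_prob_versionD[OF \<psi>[OF _ bin_borel]]
  define h where "h w = (\<Prod>m=1..n. \<psi> m (bin k x (b m)) w)" for w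
  have hm: "h \<in> borel_measurable borel" unfolding h_def using \<psi>D(1) by measurable
  have h0: "0 \<le> h w" and h1: "h w \<le> 1" for w
    unfolding h_def using \<psi>D(2,3) by (auto intro!: prod_nonneg prod_le_1)
  have "AE w in lebesgue. \<forall>m\<in>{1..n}. w \<in> {0<..<1} \<longrightarrow> block_row M X Z k x w (b m) m = \<psi> m (bin k x (b m)) w"
    using b by (intro AE_finite_allI AE_block_row_eq X Z contX contZ \<psi> k x) auto
  then have ae: "AE w in lebesgue. w \<in> {0<..<1} \<longrightarrow> (\<Prod>m=1..n. block_row M X Z k x w (b m) m) = h w"
    unfolding h_def by eventually_elim (auto intro!: prod.cong)
  show ?int by (rule lebesgue_integral_AE_eq_lborel(1)[OF hm h0 h1 ae])
  have "emeasure M {\<omega>\<in>space M. \<forall>i\<in>{1..n}. X i \<omega> \<in> bin k x (b i)} = (\<integral>\<^sup>+\<omega>. ennreal (h (?W \<omega>)) \<partial>M)"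
    unfolding h_def
    by (rule emeasure_borel_product[OF _ X _ \<psi> emeasure_atMost_product[OF _ X Z contZ ci \<psi>]])
       auto
  also have "\<dots> = ennreal (LINT w:{0..1}|lborel. h w)"
    by (rule nn_integral_uniform_transform[OF _ distr_cdf_transform[OF Z contZ] hm h0 h1]) simp
  finally have "prob {\<omega>\<in>space M. \<forall>i\<in>{1..n}. X i \<omega> \<in> bin k x (b i)} = (LINT w:{0..1}|lborel. h w)"
    unfolding emeasure_eq_measure set_lebesgue_integral_def using h0
    by (subst (asm) ennreal_inj) (auto intro!: integral_nonneg_AE)
  then show ?eq using lebesgue_integral_AE_eq_lborel(2)[OF hm h0 h1 ae] by simp
qed

section \<open>Order statistics and bin counts\<close>

lemma sort_nth_le_iff:
  fixes xs :: "'a::linorder list"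
  assumes "1 \<le> r" "r \<le> length xs"
  shows "sort xs ! (r - 1) \<le> t \<longleftrightarrow> r \<le> length (filter (\<lambda>y. y \<le> t) xs)"
proof -
  let ?s = "sort xs"
  have len: "length (filter (\<lambda>y. y \<le> t) xs) = card {i. i < length xs \<and> ?s ! i \<le> t}"
  proof -
    have "mset (filter (\<lambda>y. y \<le> t) xs) = mset (filter (\<lambda>y. y \<le> t) ?s)" by (simp add: mset_filter)
    then have "length (filter (\<lambda>y. y \<le> t) xs) = length (filter (\<lambda>y. y \<le> t) ?s)" by (rule mset_eq_length)
    then show ?thesis by (simp add: length_filter_conv_card)
  qed
  show ?thesis
  proof
    assume le: "?s ! (r - 1) \<le> t"
    have "{..<r} \<subseteq> {i. i < length xs \<and> ?s ! i \<le> t}"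
    proof
      fix i assume "i \<in> {..<r}"
      then have "i \<le> r - 1" "r - 1 < length ?s" using assms by auto
      then have "?s ! i \<le> ?s ! (r - 1)" by (intro sorted_nth_mono) auto
      then show "i \<in> {i. i < length xs \<and> ?s ! i \<le> t}" using le \<open>i \<in> {..<r}\<close> assms by auto
    qed
    from card_mono[OF _ this] show "r \<le> length (filter (\<lambda>y. y \<le> t) xs)" unfolding len by simp
  next
    assume r: "r \<le> length (filter (\<lambda>y. y \<le> t) xs)"
    show "?s ! (r - 1) \<le> t"
    proof (rule ccontr)
      assume gt: "\<not> ?s ! (r - 1) \<le> t"
      have "{i. i < length xs \<and> ?s ! i \<le> t} \<subseteq> {..<r - 1}"
      proof
        fix i assume i: "i \<in> {i. i < length xs \<and> ?s ! i \<le> t}"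
        show "i \<in> {..<r - 1}"
        proof (rule ccontr)
          assume "i \<notin> {..<r - 1}"
          then have "?s ! (r - 1) \<le> ?s ! i" using i by (intro sorted_nth_mono) auto
          then show False using gt i by auto
        qed
      qed
      from card_mono[OF _ this] show False using r assms unfolding len by simp
    qed
  qed
qed

lemma order_statistic_le_iff:
  assumes "1 \<le> r" "r \<le> n"
  shows "order_statistic n X r \<omega> \<le> t \<longleftrightarrow> r \<le> card {i\<in>{1..n}. X i \<omega> \<le> t}"
proof -
  have "order_statistic n X r \<omega> \<le> t \<longleftrightarrow> r \<le> length (filter (\<lambda>y. y \<le> t) (map (\<lambda>i. X i \<omega>) [1..<n+1]))"
    unfolding order_statistic_def using assms by (intro sort_nth_le_iff) auto
  also have "length (filter (\<lambda>y. y \<le> t) (map (\<lambda>i. X i \<omega>) [1..<n+1])) = length (filter (\<lambda>i. X i \<omega> \<le> t) [1..<n+1])"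
    by (simp add: filter_map comp_def)
  also have "\<dots> = card (set (filter (\<lambda>i. X i \<omega> \<le> t) [1..<n+1]))"
    by (rule distinct_card[symmetric]) simp
  also have "set (filter (\<lambda>i. X i \<omega> \<le> t) [1..<n+1]) = {i\<in>{1..n}. X i \<omega> \<le> t}" by auto
  finally show ?thesis .
qed

lemma sum_card_eq_card_le:
  fixes b :: "'a \<Rightarrow> nat"
  assumes A: "finite A" and b: "\<And>i. i \<in> A \<Longrightarrow> 1 \<le> b i"
  shows "(\<Sum>q=1..p. card {i\<in>A. b i = q}) = card {i\<in>A. b i \<le> p}"
proof -
  have "{i\<in>A. b i \<le> p} = (\<Union>q\<in>{1..p}. {i\<in>A. b i = q})" using b by auto
  also have "card \<dots> = (\<Sum>q=1..p. card {i\<in>A. b i = q})"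
    using A by (intro card_UN_disjoint) auto
  finally show ?thesis ..
qed

text \<open>Extensional, so that it can be compared with members of \<open>block_sizes\<close>.\<close>

definition colour_counts :: "nat \<Rightarrow> nat \<Rightarrow> (nat \<Rightarrow> nat) \<Rightarrow> nat \<Rightarrow> nat" where
  "colour_counts n k b = (\<lambda>p\<in>{1..k+1}. card {i\<in>{1..n}. b i = p})"

text \<open>\<open>X\<^bsub>r:n\<^esub> \<le> x\<^sub>p\<close> means that at least \<open>r\<close> of the variables are at most \<open>x\<^sub>p\<close>, that is, lie in the first
  \<open>p\<close> bins. So the event depends only on how many variables fall into each bin.\<close>

lemma order_statistics_le_iff_colour_counts:
  assumes x: "strict_mono_on {1..k} x" and r: "r ` {1..k} \<subseteq> {1..n}"
  shows "(\<forall>p\<in>{1..k}. order_statistic n X (r p) \<omega> \<le> x p)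
     \<longleftrightarrow> colour_counts n k (\<lambda>i\<in>{1..n}. bin_of k x (X i \<omega>)) \<in> block_sizes n k r"
proof -
  let ?b = "\<lambda>i\<in>{1..n}. bin_of k x (X i \<omega>)"
  have b: "?b i \<in> {1..k+1}" if "i \<in> {1..n}" for i using bin_of_range[of k x "X i \<omega>"] that by simp
  have partial: "(\<Sum>q=1..p. colour_counts n k ?b q) = card {i\<in>{1..n}. ?b i \<le> p}" if "p \<le> k + 1" for p
  proof -
    have "(\<Sum>q=1..p. colour_counts n k ?b q) = (\<Sum>q=1..p. card {i\<in>{1..n}. ?b i = q})"
      unfolding colour_counts_def using that by (intro sum.cong) auto
    also have "\<dots> = card {i\<in>{1..n}. ?b i \<le> p}" using b by (intro sum_card_eq_card_le) auto
    finally show ?thesis .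
  qed
  have "order_statistic n X (r p) \<omega> \<le> x p \<longleftrightarrow> r p \<le> (\<Sum>q=1..p. colour_counts n k ?b q)" if p: "p \<in> {1..k}" for p
  proof -
    have "{i\<in>{1..n}. X i \<omega> \<le> x p} = {i\<in>{1..n}. ?b i \<le> p}"
      using bin_of_le_iff[OF x p] by auto
    moreover have "r p \<in> {1..n}" using r p by blast
    then have "1 \<le> r p" "r p \<le> n" by auto
    ultimately show ?thesis using partial[of p] p by (simp add: order_statistic_le_iff)
  qed
  moreover have "(\<Sum>q=1..k+1. colour_counts n k ?b q) = n"
  proof -
    have "{i\<in>{1..n}. ?b i \<le> k + 1} = {1..n}" using b by auto
    then show ?thesis using partial[of "k+1"] by simp
  qed
  moreover have "colour_counts n k ?b \<in> {1..k+1} \<rightarrow>\<^sub>E UNIV" by (simp add: colour_counts_def)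
  ultimately show ?thesis unfolding block_sizes_def by auto
qed

lemma finite_block_sizes: "finite (block_sizes n k r)"
proof (rule finite_subset)
  show "block_sizes n k r \<subseteq> {1..k+1} \<rightarrow>\<^sub>E {0..n}"
  proof
    fix j assume j: "j \<in> block_sizes n k r"
    have "j q \<le> n" if "q \<in> {1..k+1}" for q
      using member_le_sum[of q "{1..k+1}" j] that j by (auto simp: block_sizes_def)
    then show "j \<in> {1..k+1} \<rightarrow>\<^sub>E {0..n}" using j by (auto simp: block_sizes_def PiE_def)
  qed
qed (intro finite_PiE, auto)

section \<open>Permanents of matrices with repeated rows\<close>

text \<open>A permutation that preserves \<open>\<beta>\<close> is the same thing as one permutation of each fibre of \<open>\<beta>\<close>.\<close>

lemma card_colour_preserving_permutations:
  assumes A: "finite A" and P: "finite P" and \<beta>: "\<beta> \<in> A \<rightarrow> P"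
  shows "card {\<tau>. \<tau> permutes A \<and> (\<forall>i\<in>A. \<beta> (\<tau> i) = \<beta> i)} = (\<Prod>p\<in>P. fact (card {i\<in>A. \<beta> i = p}))"
proof -
  let ?B = "\<lambda>p. {i\<in>A. \<beta> i = p}"
  let ?L = "{\<tau>. \<tau> permutes A \<and> (\<forall>i\<in>A. \<beta> (\<tau> i) = \<beta> i)}"
  let ?R = "\<Pi>\<^sub>E p\<in>P. {\<sigma>. \<sigma> permutes ?B p}"
  let ?f = "\<lambda>\<tau>. \<lambda>p\<in>P. \<lambda>i. if i \<in> ?B p then \<tau> i else i"
  let ?g = "\<lambda>F i. if i \<in> A then F (\<beta> i) i else i"
  have f: "?f \<tau> \<in> ?R" if "\<tau> \<in> ?L" for \<tau>
  proof (intro PiE_I CollectI)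
    fix p assume "p \<in> P"
    have \<tau>: "\<tau> permutes A" "\<And>i. i \<in> A \<Longrightarrow> \<beta> (\<tau> i) = \<beta> i" using that by auto
    have inj: "inj_on \<tau> (?B p)" using permutes_inj[OF \<tau>(1)] by (rule inj_on_subset) simp
    have "\<tau> ` ?B p \<subseteq> ?B p" using \<tau> permutes_in_image[OF \<tau>(1)] by auto
    then have "bij_betw \<tau> (?B p) (?B p)"
      using inj A by (simp add: bij_betw_def endo_inj_surj)
    then have "bij_betw (\<lambda>i. if i \<in> ?B p then \<tau> i else i) (?B p) (?B p)"
      by (rule bij_betw_cong[THEN iffD1, rotated]) simp
    then show "?f \<tau> p permutes ?B p" using \<open>p \<in> P\<close> by (intro bij_imp_permutes) auto
  qed auto
  have g: "?g F \<in> ?L" if F: "F \<in> ?R" for F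
  proof -
    have Fp: "F p permutes ?B p" if "p \<in> P" for p using F that by auto
    have in_B: "F (\<beta> i) i \<in> ?B (\<beta> i)" if "i \<in> A" for i
      using permutes_in_image[OF Fp, of "\<beta> i" i] \<beta> that by auto
    have "inj_on (?g F) A"
    proof (rule inj_onI)
      fix i j assume ij: "i \<in> A" "j \<in> A" "?g F i = ?g F j"
      then have "\<beta> i = \<beta> j" using in_B[of i] in_B[of j] by auto
      then show "i = j" using ij permutes_inj[OF Fp, of "\<beta> i"] \<beta> by (auto dest: injD)
    qed
    moreover have "?g F ` A \<subseteq> A" using in_B by auto
    ultimately have "bij_betw (?g F) A A" unfolding bij_betw_def using endo_inj_surj[OF A] by blast
    then have "?g F permutes A" by (rule bij_imp_permutes) simp
    then show ?thesis using in_B by auto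
  qed
  have "bij_betw ?f ?L ?R"
  proof (rule bij_betw_byWitness[where f' = ?g])
    show "\<forall>\<tau>\<in>?L. ?g (?f \<tau>) = \<tau>"
    proof (intro ballI ext)
      fix \<tau> i assume "\<tau> \<in> ?L"
      then show "?g (?f \<tau>) i = \<tau> i" using \<beta> by (auto simp: permutes_not_in)
    qed
    show "\<forall>F\<in>?R. ?f (?g F) = F"
    proof (intro ballI ext)
      fix F p i assume F: "F \<in> ?R"
      show "?f (?g F) p i = F p i"
      proof (cases "p \<in> P")
        case True
        then have "F p permutes ?B p" using F by auto
        then show ?thesis using True by (auto simp: permutes_def)
      next
        case False
        then show ?thesis using F by (auto simp: PiE_def extensional_def)
      qed
    qed
    show "?f ` ?L \<subseteq> ?R" using f by (rule image_subsetI)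
    show "?g ` ?R \<subseteq> ?L" using g by (rule image_subsetI)
  qed
  then have "card ?L = card ?R" by (rule bij_betw_same_card)
  also have "\<dots> = (\<Prod>p\<in>P. card {\<sigma>. \<sigma> permutes ?B p})" using P by (rule card_PiE)
  also have "\<dots> = (\<Prod>p\<in>P. fact (card (?B p)))"
    using A by (intro prod.cong card_permutations) auto
  finally show ?thesis .
qed

lemma ex_permutation_recolouring:
  assumes A: "finite A" and P: "finite P" and \<beta>: "\<beta> \<in> A \<rightarrow> P" and b: "b \<in> A \<rightarrow> P"
    and card: "\<And>p. p \<in> P \<Longrightarrow> card {i\<in>A. b i = p} = card {i\<in>A. \<beta> i = p}"
  shows "\<exists>\<sigma>. \<sigma> permutes A \<and> (\<forall>i\<in>A. \<beta> (\<sigma> i) = b i)"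
proof -
  have "\<exists>h. bij_betw h {i\<in>A. b i = p} {i\<in>A. \<beta> i = p}" if "p \<in> P" for p
    using card[OF that] A by (intro finite_same_card_bij) auto
  then obtain h where h: "\<And>p. p \<in> P \<Longrightarrow> bij_betw (h p) {i\<in>A. b i = p} {i\<in>A. \<beta> i = p}" by metis
  let ?g = "\<lambda>i. if i \<in> A then h (b i) i else i"
  have in_B: "h (b i) i \<in> A \<and> \<beta> (h (b i) i) = b i" if "i \<in> A" for i
    using bij_betwE[OF h, of "b i"] b that by auto
  have "inj_on ?g A"
  proof (rule inj_onI)
    fix i j assume ij: "i \<in> A" "j \<in> A" "?g i = ?g j"
    then have "b i = b j" using in_B[of i] in_B[of j] by auto
    then show "i = j" using ij bij_betw_imp_inj_on[OF h, of "b i"] b by (auto dest: inj_onD)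
  qed
  moreover have "?g ` A \<subseteq> A" using in_B by auto
  ultimately have "bij_betw ?g A A" unfolding bij_betw_def using endo_inj_surj[OF A] by blast
  then have "?g permutes A" by (rule bij_imp_permutes) simp
  then show ?thesis using in_B by (intro exI[of _ ?g]) auto
qed

text \<open>This is why a permanent with repeated rows is divided by factorials. The colouring \<open>\<beta>\<close> says which block a row belongs to, and
  \<open>\<beta> \<circ> \<sigma>\<close> is the induced assignment of blocks to columns. Every assignment with the colour frequencies of \<open>\<beta>\<close> arises, and
  it arises from a coset of the colour-preserving permutations.\<close>

lemma sum_permutations_eq_sum_colourings:
  fixes h :: "('a \<Rightarrow> 'b) \<Rightarrow> real"
  assumes A: "finite A" and P: "finite P" and \<beta>: "\<beta> \<in> A \<rightarrow> P"
  shows "(\<Sum>\<sigma> | \<sigma> permutes A. h (restrict (\<beta> \<circ> \<sigma>) A))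
    = (\<Prod>p\<in>P. fact (card {i\<in>A. \<beta> i = p}))
      * (\<Sum>b | b \<in> A \<rightarrow>\<^sub>E P \<and> (\<forall>p\<in>P. card {i\<in>A. b i = p} = card {i\<in>A. \<beta> i = p}). h b)"
proof -
  let ?S = "{\<sigma>. \<sigma> permutes A}"
  let ?T = "{b. b \<in> A \<rightarrow>\<^sub>E P \<and> (\<forall>p\<in>P. card {i\<in>A. b i = p} = card {i\<in>A. \<beta> i = p})}"
  let ?r = "\<lambda>\<sigma>. restrict (\<beta> \<circ> \<sigma>) A"
  let ?N = "\<Prod>p\<in>P. fact (card {i\<in>A. \<beta> i = p})"
  have fS: "finite ?S" by (rule finite_permutations[OF A])
  have fT: "finite ?T"
    by (rule finite_subset[OF _ finite_PiE[OF A, of "\<lambda>_. P"]]) (use P in auto)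
  have img: "?r ` ?S \<subseteq> ?T"
  proof
    fix b assume "b \<in> ?r ` ?S"
    then obtain \<sigma> where \<sigma>: "\<sigma> permutes A" and b: "b = ?r \<sigma>" by auto
    have "card {i\<in>A. b i = p} = card {i\<in>A. \<beta> i = p}" for p
    proof (rule bij_betw_same_card)
      have "\<sigma> ` {i\<in>A. b i = p} = {i\<in>A. \<beta> i = p}"
      proof
        show "\<sigma> ` {i\<in>A. b i = p} \<subseteq> {i\<in>A. \<beta> i = p}"
          using permutes_in_image[OF \<sigma>] by (auto simp: b)
        show "{i\<in>A. \<beta> i = p} \<subseteq> \<sigma> ` {i\<in>A. b i = p}"
        proof
          fix i assume i: "i \<in> {i\<in>A. \<beta> i = p}"
          then have "inv \<sigma> i \<in> A" "\<sigma> (inv \<sigma> i) = i"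
            using permutes_in_image[OF permutes_inv[OF \<sigma>]] permutes_inverses(1)[OF \<sigma>] by auto
          then show "i \<in> \<sigma> ` {i\<in>A. b i = p}" using i by (intro image_eqI[of _ _ "inv \<sigma> i"]) (auto simp: b)
        qed
      qed
      then show "bij_betw \<sigma> {i\<in>A. b i = p} {i\<in>A. \<beta> i = p}"
        using permutes_inj_on[OF \<sigma>] by (auto simp: bij_betw_def)
    qed
    moreover have "b \<in> A \<rightarrow>\<^sub>E P" using \<beta> permutes_in_image[OF \<sigma>] by (auto simp: b)
    ultimately show "b \<in> ?T" by simp
  qed
  have fib: "card {\<sigma>\<in>?S. ?r \<sigma> = b} = ?N" if bT: "b \<in> ?T" for b
  proof -
    have b: "b \<in> A \<rightarrow> P" using bT by (auto simp: PiE_def)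
    obtain \<sigma>0 where \<sigma>0: "\<sigma>0 permutes A" "\<And>i. i \<in> A \<Longrightarrow> \<beta> (\<sigma>0 i) = b i"
      using ex_permutation_recolouring[OF A P \<beta> b] bT by auto
    let ?L = "{\<tau>. \<tau> permutes A \<and> (\<forall>i\<in>A. \<beta> (\<tau> i) = \<beta> i)}"
    have bij: "bij_betw (\<lambda>\<tau>. \<tau> \<circ> \<sigma>0) ?L {\<sigma>\<in>?S. ?r \<sigma> = b}"
    proof (rule bij_betw_byWitness[where f' = "\<lambda>\<sigma>. \<sigma> \<circ> inv \<sigma>0"])
      show "\<forall>\<tau>\<in>?L. \<tau> \<circ> \<sigma>0 \<circ> inv \<sigma>0 = \<tau>" using permutes_inv_o(1)[OF \<sigma>0(1)] by (simp add: comp_assoc)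
      show "\<forall>\<sigma>\<in>{\<sigma>\<in>?S. ?r \<sigma> = b}. \<sigma> \<circ> inv \<sigma>0 \<circ> \<sigma>0 = \<sigma>" using permutes_inv_o(2)[OF \<sigma>0(1)] by (simp add: comp_assoc)
      show "(\<lambda>\<tau>. \<tau> \<circ> \<sigma>0) ` ?L \<subseteq> {\<sigma>\<in>?S. ?r \<sigma> = b}"
      proof (rule image_subsetI)
        fix \<tau> assume \<tau>: "\<tau> \<in> ?L"
        have "?r (\<tau> \<circ> \<sigma>0) i = b i" for i
          using \<tau> \<sigma>0 bT permutes_in_image[OF \<sigma>0(1), of i] by (cases "i \<in> A") (auto simp: PiE_def extensional_def)
        then show "\<tau> \<circ> \<sigma>0 \<in> {\<sigma>\<in>?S. ?r \<sigma> = b}" using \<tau> \<sigma>0(1) by (auto intro: permutes_compose)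
      qed
      show "(\<lambda>\<sigma>. \<sigma> \<circ> inv \<sigma>0) ` {\<sigma>\<in>?S. ?r \<sigma> = b} \<subseteq> ?L"
      proof (rule image_subsetI)
        fix \<sigma> assume \<sigma>: "\<sigma> \<in> {\<sigma>\<in>?S. ?r \<sigma> = b}"
        have "\<beta> ((\<sigma> \<circ> inv \<sigma>0) i) = \<beta> i" if "i \<in> A" for i
        proof -
          have i: "inv \<sigma>0 i \<in> A" "\<sigma>0 (inv \<sigma>0 i) = i"
            using that permutes_in_image[OF permutes_inv[OF \<sigma>0(1)]] permutes_inverses(1)[OF \<sigma>0(1)] by auto
          have "\<beta> (\<sigma> (inv \<sigma>0 i)) = ?r \<sigma> (inv \<sigma>0 i)" using i(1) by simp
          also have "\<dots> = b (inv \<sigma>0 i)" using \<sigma> by simp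
          also have "\<dots> = \<beta> i" using \<sigma>0(2)[OF i(1)] i(2) by simp
          finally show ?thesis by simp
        qed
        then show "\<sigma> \<circ> inv \<sigma>0 \<in> ?L" using \<sigma> \<sigma>0(1) by (auto intro: permutes_compose permutes_inv)
      qed
    qed
    show ?thesis
      using bij_betw_same_card[OF bij] card_colour_preserving_permutations[OF A P \<beta>] by simp
  qed
  have "(\<Sum>\<sigma>\<in>?S. h (?r \<sigma>)) = (\<Sum>b\<in>?T. \<Sum>\<sigma>\<in>{\<sigma>\<in>?S. ?r \<sigma> = b}. h (?r \<sigma>))"
    by (rule sum.group[OF fS fT img, symmetric])
  also have "\<dots> = (\<Sum>b\<in>?T. real (card {\<sigma>\<in>?S. ?r \<sigma> = b}) * h b)"
    by (intro sum.cong refl) simp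
  also have "\<dots> = (\<Sum>b\<in>?T. ?N * h b)"
    using fib by (intro sum.cong refl) (simp add: of_nat_prod)
  finally show ?thesis by (simp add: sum_distrib_left)
qed

text \<open>The block to which row \<open>i\<close> belongs when blocks of sizes \<open>j 1, j 2, \<dots>\<close> are stacked; written like the list of rows in
  \<open>block_matrix\<close> so that the two are related by mapping.\<close>

definition block_label :: "nat \<Rightarrow> (nat \<Rightarrow> nat) \<Rightarrow> nat \<Rightarrow> nat" where
  "block_label k j i = concat (map (\<lambda>p. replicate (j p) p) [1..<k+2]) ! (i - 1)"

lemma length_block_labels:
  "length (concat (map (\<lambda>p. replicate (j p) p) [1..<k+2])) = (\<Sum>q=1..k+1. j q)"
proof -
  have "length (concat (map (\<lambda>p. replicate (j p) p) [1..<k+2])) = sum_list (map j [1..<k+2])"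
    by (simp add: length_concat comp_def)
  also have "\<dots> = sum j (set [1..<k+2])" by (rule sum_list_distinct_conv_sum_set) simp
  also have "set [1..<k+2] = {1..k+1}" by auto
  finally show ?thesis .
qed

lemma card_block_label:
  assumes n: "(\<Sum>q=1..k+1. j q) = n" and p: "p \<in> {1..k+1}"
  shows "card {i\<in>{1..n}. block_label k j i = p} = j p"
proof -
  define L where "L = concat (map (\<lambda>p. replicate (j p) p) [1..<k+2])"
  have len: "length L = n" using length_block_labels[of j k] n by (simp only: L_def)
  have label: "block_label k j i = L ! (i - 1)" for i by (simp only: block_label_def L_def)
  have "card {i\<in>{1..n}. block_label k j i = p} = card {i. i < length L \<and> L ! i = p}"
  proof (rule bij_betw_same_card)
    show "bij_betw (\<lambda>i. i - 1) {i\<in>{1..n}. block_label k j i = p} {i. i < length L \<and> L ! i = p}"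
      by (rule bij_betw_byWitness[where f' = Suc]) (auto simp: label len)
  qed
  also have "\<dots> = length (filter (\<lambda>y. y = p) L)" by (simp add: length_filter_conv_card)
  also have "\<dots> = sum_list (map (\<lambda>q. if q = p then j q else 0) [1..<k+2])"
    unfolding L_def filter_concat length_concat map_map
    by (intro arg_cong[where f=sum_list] map_cong refl) (auto simp: filter_replicate)
  also have "\<dots> = (\<Sum>q\<in>set [1..<k+2]. if q = p then j q else 0)"
    by (rule sum_list_distinct_conv_sum_set) simp
  also have "set [1..<k+2] = {1..k+1}" by auto
  also have "(\<Sum>q\<in>{1..k+1}. if q = p then j q else 0) = j p" using p by (subst sum.delta) auto
  finally show ?thesis .
qed

lemma block_label_range:
  assumes n: "(\<Sum>q=1..k+1. j q) = n"
  shows "block_label k j \<in> {1..n} \<rightarrow> {1..k+1}"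
proof
  let ?L = "concat (map (\<lambda>p. replicate (j p) p) [1..<k+2])"
  fix i assume "i \<in> {1..n}"
  then have "block_label k j i \<in> set ?L"
    unfolding block_label_def using length_block_labels[of j k] n by (intro nth_mem) auto
  then show "block_label k j i \<in> {1..k+1}" by auto
qed

lemma block_matrix_eq_row:
  assumes n: "(\<Sum>q=1..k+1. j q) = n" and i: "i \<in> {1..n}"
  shows "block_matrix M X Z k j x w i = block_row M X Z k x w (block_label k j i)"
proof -
  let ?L = "concat (map (\<lambda>p. replicate (j p) p) [1..<k+2])"
  have eq: "concat (map (\<lambda>p. replicate (j p) (block_row M X Z k x w p)) [1..<k+2]) = map (block_row M X Z k x w) ?L"
    by (simp only: map_concat map_map comp_def map_replicate)
  have "i - 1 < length ?L" using length_block_labels[of j k] n i by auto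
  then show ?thesis
    unfolding block_matrix_def block_label_def eq by (rule nth_map)
qed

text \<open>The permanent is invariant under transposition. Grouping by columns collects one factor for each random variable.\<close>

lemma permanent_eq_sum_columns:
  "permanent n A = (\<Sum>\<sigma> | \<sigma> permutes {1..n}. \<Prod>m=1..n. A (\<sigma> m) m)"
proof -
  have "(\<Prod>m=1..n. A (inv \<sigma> m) m) = (\<Prod>i=1..n. A i (\<sigma> i))" if \<sigma>: "\<sigma> permutes {1..n}" for \<sigma>
  proof -
    have "(\<Prod>m=1..n. A (inv \<sigma> m) m) = (\<Prod>i=1..n. A (inv \<sigma> (\<sigma> i)) (\<sigma> i))"
      using prod.permute[OF \<sigma>, of "\<lambda>m. A (inv \<sigma> m) m"] by (simp add: comp_def)
    then show ?thesis by (simp add: permutes_inverses(2)[OF \<sigma>])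
  qed
  then have "permanent n A = (\<Sum>\<sigma> | \<sigma> permutes {1..n}. \<Prod>m=1..n. A (inv \<sigma> m) m)"
    unfolding permanent_def by (intro sum.cong) auto
  also have "\<dots> = (\<Sum>\<sigma> | \<sigma> permutes {1..n}. \<Prod>m=1..n. A (\<sigma> m) m)"
    by (rule sum_permutations_inverse[symmetric])
  finally show ?thesis .
qed

section \<open>The distribution of several order statistics\<close>

theorem mainTheorem5:
  fixes M :: "'a measure" and X :: "nat \<Rightarrow> 'a \<Rightarrow> real" and Z :: "'a \<Rightarrow> real"
    and n k :: nat and r :: "nat \<Rightarrow> nat" and x :: "nat \<Rightarrow> real"
  assumes "prob_space M"
    and "1 \<le> n"
    and "\<And>i. i \<in> {1..n} \<Longrightarrow> X i \<in> borel_measurable M"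
    and "Z \<in> borel_measurable M"
    and "\<And>i. i \<in> {1..n} \<Longrightarrow> absolutely_continuous lborel (distr M borel (X i))"
    and "absolutely_continuous lborel (distr M borel Z)"
    and "cond_indep_given M X {1..n} Z"
    and "1 \<le> k"
    and "strict_mono_on {1..k} r" and "r ` {1..k} \<subseteq> {1..n}"
    and "strict_mono_on {1..k} x"
  shows "measure M {\<omega> \<in> space M. \<forall>p\<in>{1..k}. order_statistic n X (r p) \<omega> \<le> x p} =
    (\<Sum>j\<in>block_sizes n k r.
       1 / (\<Prod>p=1..k+1. fact (j p))
         * (LINT w:{0..1}|lebesgue. permanent n (block_matrix M X Z k j x w)))"
proof -
  interpret prob_space M by fact
  note X = assms(3) and x = assms(11)
  have contX: "isCont (cdf (distr M borel (X i))) z" if "i \<in> {1..n}" for i z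
    by (rule isCont_cdf_distr[OF X[OF that] assms(5)[OF that]])
  have contZ: "isCont (cdf (distr M borel Z)) z" for z
    by (rule isCont_cdf_distr[OF assms(4,6)])
  let ?C = "{1..n} \<rightarrow>\<^sub>E {1..k+1}"
  let ?BS = "block_sizes n k r"
  let ?E = "\<lambda>b. {\<omega>\<in>space M. \<forall>i\<in>{1..n}. X i \<omega> \<in> bin k x (b i)}"
  let ?f = "\<lambda>b w. \<Prod>m=1..n. block_row M X Z k x w (b m) m"
  define I where "I b = (LINT w:{0..1}|lebesgue. ?f b w)" for b
  have fC: "finite ?C" by (intro finite_PiE) auto
  note bins = prob_bins_eq_integral[OF X assms(4) contX contZ assms(7,8) x]
  have E: "?E b \<in> events" for b
  proof -
    have "{\<omega>\<in>space M. X i \<omega> \<in> bin k x (b i)} \<in> events" if "i \<in> {1..n}" for i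
      using measurable_sets[OF X[OF that] bin_borel] by (simp add: vimage_def Int_def conj_commute)
    then show ?thesis by (intro sets.sets_Collect_finite_All) auto
  qed
  have mem_E: "\<omega> \<in> ?E b \<longleftrightarrow> \<omega> \<in> space M \<and> b = (\<lambda>i\<in>{1..n}. bin_of k x (X i \<omega>))" if b: "b \<in> ?C" for \<omega> b
  proof -
    have bi: "X i \<omega> \<in> bin k x (b i) \<longleftrightarrow> bin_of k x (X i \<omega>) = b i" if "i \<in> {1..n}" for i
      by (rule mem_bin_iff[OF x PiE_mem[OF b that]])
    have "b = (\<lambda>i\<in>{1..n}. bin_of k x (X i \<omega>)) \<longleftrightarrow> (\<forall>i\<in>{1..n}. bin_of k x (X i \<omega>) = b i)"
      using PiE_arb[OF b] by (auto simp: fun_eq_iff restrict_def)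
    with bi show ?thesis by simp
  qed
  (* The event splits according to the assignment of variables to bins. *)
  let ?G = "{b\<in>?C. colour_counts n k b \<in> ?BS}"
  have "{\<omega> \<in> space M. \<forall>p\<in>{1..k}. order_statistic n X (r p) \<omega> \<le> x p} = (\<Union>b\<in>?G. ?E b)"
  proof (rule set_eqI)
    fix \<omega>
    let ?b = "\<lambda>i\<in>{1..n}. bin_of k x (X i \<omega>)"
    have bC: "?b \<in> ?C" by (rule restrict_PiE_iff[THEN iffD2]) (use bin_of_range in blast)
    have "\<omega> \<in> (\<Union>b\<in>?G. ?E b) \<longleftrightarrow> (\<exists>b\<in>?G. \<omega> \<in> ?E b)" by (rule UN_iff)
    also have "\<dots> \<longleftrightarrow> (\<exists>b\<in>?G. \<omega> \<in> space M \<and> b = ?b)" by (intro bex_cong[OF refl] mem_E) (elim CollectE conjE)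
    also have "\<dots> \<longleftrightarrow> \<omega> \<in> space M \<and> colour_counts n k ?b \<in> ?BS" using bC by blast
    also have "\<dots> \<longleftrightarrow> \<omega> \<in> {\<omega> \<in> space M. \<forall>p\<in>{1..k}. order_statistic n X (r p) \<omega> \<le> x p}"
      unfolding mem_Collect_eq order_statistics_le_iff_colour_counts[OF x assms(10)] ..
    finally show "\<omega> \<in> {\<omega> \<in> space M. \<forall>p\<in>{1..k}. order_statistic n X (r p) \<omega> \<le> x p} \<longleftrightarrow> \<omega> \<in> (\<Union>b\<in>?G. ?E b)" ..
  qed
  then have "measure M {\<omega> \<in> space M. \<forall>p\<in>{1..k}. order_statistic n X (r p) \<omega> \<le> x p} = prob (\<Union>b\<in>?G. ?E b)"
    by simp
  also have "\<dots> = (\<Sum>b\<in>?G. prob (?E b))"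
  proof (rule finite_measure_finite_Union)
    show "disjoint_family_on ?E ?G"
      unfolding disjoint_family_on_def
    proof (intro ballI impI)
      fix b b' assume b: "b \<in> ?G" "b' \<in> ?G" "b \<noteq> b'"
      then have "b \<in> ?C" "b' \<in> ?C" by auto
      note bC = mem_E[OF this(1)] mem_E[OF this(2)]
      show "?E b \<inter> ?E b' = {}"
      proof (rule equals0I)
        fix \<omega> assume "\<omega> \<in> ?E b \<inter> ?E b'"
        then have "\<omega> \<in> ?E b \<and> \<omega> \<in> ?E b'" by (rule Int_iff[THEN iffD1])
        then show False using b(3) unfolding bC by blast
      qed
    qed
  qed (use fC E in auto)
  also have "\<dots> = (\<Sum>b\<in>?G. I b)"
    unfolding I_def by (intro sum.cong bins(2)) (auto simp: PiE_def)
  (* Collect the assignments with the same bin counts; they share one permanent. *)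
  also have "\<dots> = (\<Sum>j\<in>?BS. \<Sum>b\<in>{b\<in>?G. colour_counts n k b = j}. I b)"
    using fC by (intro sum.group[symmetric] finite_block_sizes) auto
  also have "\<dots> = (\<Sum>j\<in>?BS. 1 / (\<Prod>p=1..k+1. fact (j p))
         * (LINT w:{0..1}|lebesgue. permanent n (block_matrix M X Z k j x w)))"
  proof (rule sum.cong[OF refl])
    fix j assume j: "j \<in> ?BS"
    then have n: "(\<Sum>q=1..k+1. j q) = n" and je: "j \<in> {1..k+1} \<rightarrow>\<^sub>E UNIV" by (auto simp: block_sizes_def)
    let ?\<beta> = "block_label k j"
    note \<beta> = block_label_range[OF n] and card = card_block_label[OF n]
    let ?S = "{\<sigma>. \<sigma> permutes {1..n}}"
    have counts: "colour_counts n k b = j \<longleftrightarrow> (\<forall>p\<in>{1..k+1}. card {i\<in>{1..n}. b i = p} = card {i\<in>{1..n}. ?\<beta> i = p})" for b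
      using je card by (auto simp: colour_counts_def fun_eq_iff PiE_def extensional_def)
    have perm: "permanent n (block_matrix M X Z k j x w) = (\<Sum>\<sigma>\<in>?S. ?f (restrict (?\<beta> \<circ> \<sigma>) {1..n}) w)" for w
      unfolding permanent_eq_sum_columns
    proof (intro sum.cong prod.cong refl)
      fix \<sigma> m assume "\<sigma> \<in> ?S" "m \<in> {1..n}"
      then have "\<sigma> m \<in> {1..n}" using permutes_in_image[of \<sigma> "{1..n}" m] by simp
      then show "block_matrix M X Z k j x w (\<sigma> m) m = block_row M X Z k x w (restrict (?\<beta> \<circ> \<sigma>) {1..n} m) m"
        using \<open>m \<in> {1..n}\<close> by (simp add: block_matrix_eq_row[OF n])
    qed
    have "set_integrable lebesgue {0..1} (?f (restrict (?\<beta> \<circ> \<sigma>) {1..n}))" if "\<sigma> \<in> ?S" for \<sigma>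
    proof -
      have "restrict (?\<beta> \<circ> \<sigma>) {1..n} \<in> {1..n} \<rightarrow> {1..k+1}"
      proof (rule Pi_I)
        fix i assume i: "i \<in> {1..n}"
        then have "\<sigma> i \<in> {1..n}" using permutes_in_image[of \<sigma> "{1..n}" i] that by simp
        then show "restrict (?\<beta> \<circ> \<sigma>) {1..n} i \<in> {1..k+1}" using \<beta> i by (simp add: Pi_iff)
      qed
      then show ?thesis by (intro bins(1))
    qed
    then have "(LINT w:{0..1}|lebesgue. permanent n (block_matrix M X Z k j x w))
        = (\<Sum>\<sigma>\<in>?S. I (restrict (?\<beta> \<circ> \<sigma>) {1..n}))"
      unfolding perm I_def set_lebesgue_integral_def set_integrable_def scaleR_sum_right
      by (intro Bochner_Integration.integral_sum)
    also have "\<dots> = (\<Prod>p\<in>{1..k+1}. fact (card {i\<in>{1..n}. ?\<beta> i = p}))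
        * (\<Sum>b | b \<in> ?C \<and> (\<forall>p\<in>{1..k+1}. card {i\<in>{1..n}. b i = p} = card {i\<in>{1..n}. ?\<beta> i = p}). I b)"
      by (rule sum_permutations_eq_sum_colourings[OF _ _ \<beta>]) auto
    also have "(\<Prod>p\<in>{1..k+1}. fact (card {i\<in>{1..n}. ?\<beta> i = p})) = (\<Prod>p=1..k+1. fact (j p) :: real)"
      by (intro prod.cong refl) (simp only: card)
    also have "{b. b \<in> ?C \<and> (\<forall>p\<in>{1..k+1}. card {i\<in>{1..n}. b i = p} = card {i\<in>{1..n}. ?\<beta> i = p})}
        = {b\<in>?G. colour_counts n k b = j}"
      unfolding counts[symmetric] mem_Collect_eq using j by (intro Collect_cong) metis
    finally have "(LINT w:{0..1}|lebesgue. permanent n (block_matrix M X Z k j x w))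
        = (\<Prod>p=1..k+1. fact (j p)) * (\<Sum>b\<in>{b\<in>?G. colour_counts n k b = j}. I b)" .
    moreover have "(\<Prod>p=1..k+1. fact (j p)) \<noteq> (0 :: real)" by (simp add: prod_zero_iff)
    ultimately show "(\<Sum>b\<in>{b\<in>?G. colour_counts n k b = j}. I b) = 1 / (\<Prod>p=1..k+1. fact (j p))
         * (LINT w:{0..1}|lebesgue. permanent n (block_matrix M X Z k j x w))" by simp
  qed
  finally show ?thesis .
qed

end
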